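(* Let $D\ge3$, $q\ge1$, and let $\Gamma_q$ be a connected combinatorial map with edges colored in $\{1,\dots,D\}$ and $q$ marked corners on $q$ different vertices, with connected boundary graph $B=\partial\Gamma_q$, and let $\Omega$ be the pairing of $B$ induced by $\Gamma_q$. Then its degree is bounded from below: $$\delta(\Gamma_q)\ge1+(D-1)\bigl(q+L_m(B_{/\Omega})\bigr).$$ Moreover equality holds if and only if the following three conditions hold: (i) $\Gamma_q^{(i)}$ is a forest for each $i\in\{1,\dots,D\}$; (ii) denoting $\mathcal{T}_{ext}^{(i)}$ the restriction of $\Gamma_q^{(i)}$ to its trees which have at least one marked vertex, those trees (for different colors) can meet on marked vertices only; (iii) $\Gamma_q\setminus\bigcup_{i}\mathcal{T}_{ext}^{(i)}$ is a forest whose trees each meet $\bigcup_i\mathcal{T}_{ext}^{(i)}$ at a single vertex.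
   Context: A combinatorial map is a finite graph (loops, multiple edges allowed) with a cyclic (counterclockwise) order of half-edges around each vertex; each edge here has one color in $\{1,\dots,D\}$; a corner is a pair of consecutive half-edges at a vertex; a marked vertex is a vertex with a marked corner. $\Gamma^{(i)}$ is the submap with all vertices of $\Gamma$ and only the edges of color $i$; each marked corner lies in a corner of $\Gamma^{(i)}$. $F_{int}(\Gamma^{(i)})$ is the number of faces of $\Gamma^{(i)}$ (an isolated vertex has one face) which meet no marked corner. The degree is $$\delta(\Gamma_q)=D+(D-1)E(\Gamma_q)-\sum_{i=1}^DF_{int}(\Gamma_q^{(i)}).$$ Boundary graph $\partial\Gamma_q$ with induced pairing $\Omega$: for each marked vertex take one black and one white vertex, forming a pair of $\Omega$; orient the faces of each $\Gamma_q^{(i)}$ consistently (visiting corners counterclockwise around vertices); whenever, following a face of $\Gamma_q^{(i)}$ from the marked corner at $v_a$, the next marked corner met is at $v_b$ (possibly $v_a=v_b$), put an edge of color $i$ from the black vertex of $v_a$ to the white vertex of $v_b$. This gives a bipartite graph with exactly one edge of each color $1,\dots,D$ at each vertex. $B_{/\Omega}$ is the graph obtained from $B$ by contracting each pair of $\Omega$ into a single vertex (so the edges of $B$ are kept, those inside a pair becoming loops); $B_{/\Omega}^{(i)}$ is its subgraph with all vertices and only color-$i$ edges. $L=E-V+K$ is the circuit-rank ($K$ = number of connected components) and $L_m(B_{/\Omega})=L(B_{/\Omega})-\sum_{i=1}^DL(B_{/\Omega}^{(i)})$ is the number of independent polychromatic cycles. *)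

theory Defs
  imports "Graph_Theory.Graph_Theory" "HOL-Combinatorics.Orbits"
begin

section \<open>Undirected multigraph notions\<close>

text \<open>
  A digraph \<open>G\<close> is read as an undirected multigraph with one edge per arc when its
  circuit-rank is taken; connected components ignore directions. Components are given by
  their vertex sets.
\<close>

definition components :: "('a, 'b) pre_digraph \<Rightarrow> 'a set set" where
  "components G = pre_digraph.sccs_verts (with_proj (mk_symmetric G))"

definition circuit_rank :: "('a, 'b) pre_digraph \<Rightarrow> int" where
  "circuit_rank G = int (card (arcs G)) - int (card (verts G)) + int (card (components G))"

definition color_part :: "('a, 'b) pre_digraph \<Rightarrow> ('b \<Rightarrow> nat) \<Rightarrow> nat \<Rightarrow> ('a, 'b) pre_digraph" where
  "color_part G col i = G\<lparr>arcs := {a \<in> arcs G. col a = i}\<rparr>"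

text \<open>
  In a bidirected digraph an undirected edge is a pair \<open>{a, r a}\<close> of mutually reverse arcs.
  A cycle of the undirected multigraph may not use the same edge twice; the predicate
  \<open>forest\<close> of the library is about directed cycles and already rejects a single bidirected
  edge.
\<close>

definition bidirected_forest :: "('a, 'b) pre_digraph \<Rightarrow> ('b \<Rightarrow> 'b) \<Rightarrow> bool" where
  "bidirected_forest G r \<longleftrightarrow>
     \<not> (\<exists>p. pre_digraph.cycle G p \<and> distinct (map (\<lambda>a. {a, r a}) p))"


section \<open>Combinatorial maps\<close>

text \<open>
  Half-edges are the arcs of a bidirected digraph: \<open>tail\<close> is the vertex to which a half-edge
  is attached, \<open>erev\<close> sends it to the other half of its edge, and \<open>esucc\<close> to the next
  half-edge counterclockwise around its vertex.
\<close>

record ('v, 'h) cmap =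
  mgraph :: "('v, 'h) pre_digraph"
  erev :: "'h \<Rightarrow> 'h"
  esucc :: "'h \<Rightarrow> 'h"
  ecol :: "'h \<Rightarrow> nat"

locale colored_map =
  fin_digraph "mgraph M" + bidirected_digraph "mgraph M" "erev M"
  for D :: nat and M :: "('v, 'h) cmap" +
  assumes esucc_permutes: "esucc M permutes arcs (mgraph M)"
    and esucc_cyclic: "\<And>v. v \<in> verts (mgraph M) \<Longrightarrow> out_arcs (mgraph M) v \<noteq> {} \<Longrightarrow>
          cyclic_on (esucc M) (out_arcs (mgraph M) v)"
    and ecol_range: "\<And>a. a \<in> arcs (mgraph M) \<Longrightarrow> ecol M a \<in> {1..D}"
    and ecol_erev: "\<And>a. a \<in> arcs (mgraph M) \<Longrightarrow> ecol M (erev M a) = ecol M a"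

definition map_edges :: "('v, 'h) cmap \<Rightarrow> 'h set set" where
  "map_edges M = (\<lambda>a. {a, erev M a}) ` arcs (mgraph M)"

definition first_return :: "('a \<Rightarrow> 'a) \<Rightarrow> 'a set \<Rightarrow> 'a \<Rightarrow> 'a" where
  "first_return f S x = (f ^^ (LEAST k. 0 < k \<and> (f ^^ k) x \<in> S)) x"

text \<open>The cyclic order around each vertex of a submap is inherited by skipping half-edges.\<close>

definition color_submap :: "('v, 'h) cmap \<Rightarrow> nat \<Rightarrow> ('v, 'h) cmap" where
  "color_submap M i = (let A = {a \<in> arcs (mgraph M). ecol M a = i} in
     \<lparr>mgraph = color_part (mgraph M) (ecol M) i,
      erev = (\<lambda>a. if a \<in> A then erev M a else a),
      esucc = (\<lambda>a. if a \<in> A then first_return (esucc M) A a else a),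
      ecol = ecol M\<rparr>)"

text \<open>
  \<open>After a\<close> is the corner \<open>(a, esucc M a)\<close>; \<open>Lone v\<close> is the unique corner of an isolated
  vertex.
\<close>

datatype ('v, 'h) corner = After 'h | Lone 'v

definition corners :: "('v, 'h) cmap \<Rightarrow> ('v, 'h) corner set" where
  "corners M = After ` arcs (mgraph M) \<union>
     Lone ` {v \<in> verts (mgraph M). out_arcs (mgraph M) v = {}}"

fun corner_vertex :: "('v, 'h) cmap \<Rightarrow> ('v, 'h) corner \<Rightarrow> 'v" where
  "corner_vertex M (After a) = tail (mgraph M) a"
| "corner_vertex M (Lone v) = v"

text \<open>
  The face is left along \<open>esucc M a\<close>, so that the corner \<open>(a, esucc M a)\<close> is crossed
  counterclockwise, and the next corner begins at the other half of that edge.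
\<close>

fun face_succ :: "('v, 'h) cmap \<Rightarrow> ('v, 'h) corner \<Rightarrow> ('v, 'h) corner" where
  "face_succ M (After a) = After (erev M (esucc M a))"
| "face_succ M (Lone v) = Lone v"

definition faces :: "('v, 'h) cmap \<Rightarrow> ('v, 'h) corner set set" where
  "faces M = orbit (face_succ M) ` corners M"

text \<open>
  The corner of \<open>color_submap M i\<close> containing a given corner of \<open>M\<close>: go back clockwise to the
  nearest half-edge of color \<open>i\<close> at the same vertex, if there is one.
\<close>

fun color_corner :: "('v, 'h) cmap \<Rightarrow> nat \<Rightarrow> ('v, 'h) corner \<Rightarrow> ('v, 'h) corner" where
  "color_corner M i (After a) =
     (let A = {b \<in> arcs (mgraph M). tail (mgraph M) b = tail (mgraph M) a \<and> ecol M b = i} in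
      if A = {} then Lone (tail (mgraph M) a)
      else After ((inv (esucc M) ^^ (LEAST k. (inv (esucc M) ^^ k) a \<in> A)) a))"
| "color_corner M i (Lone v) = Lone v"


section \<open>Maps with marked corners\<close>

definition marked_corners :: "('v, 'h) cmap \<Rightarrow> ('v, 'h) corner set \<Rightarrow> bool" where
  "marked_corners M C \<longleftrightarrow> C \<subseteq> corners M \<and> inj_on (corner_vertex M) C"

definition marked_verts :: "('v, 'h) cmap \<Rightarrow> ('v, 'h) corner set \<Rightarrow> 'v set" where
  "marked_verts M C = corner_vertex M ` C"

definition internal_faces :: "('v, 'h) cmap \<Rightarrow> ('v, 'h) corner set \<Rightarrow> nat \<Rightarrow> ('v, 'h) corner set set" where
  "internal_faces M C i = {f \<in> faces (color_submap M i). f \<inter> color_corner M i ` C = {}}"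

definition degree :: "nat \<Rightarrow> ('v, 'h) cmap \<Rightarrow> ('v, 'h) corner set \<Rightarrow> int" where
  "degree D M C = int D + (int D - 1) * int (card (map_edges M))
     - (\<Sum>i\<in>{1..D}. int (card (internal_faces M C i)))"


section \<open>Boundary graph and contraction of its pairing\<close>

datatype shade = Black | White

text \<open>
  The arc \<open>(i, c)\<close> is the edge of color \<open>i\<close> leaving the black vertex of the marked corner
  \<open>c\<close>; all arcs point from black to white.
\<close>

definition boundary_graph ::
    "nat \<Rightarrow> ('v, 'h) cmap \<Rightarrow> ('v, 'h) corner set
      \<Rightarrow> ('v \<times> shade, nat \<times> ('v, 'h) corner) pre_digraph" where
  "boundary_graph D M C =
     \<lparr>verts = marked_verts M C \<times> {Black, White},
      arcs = {1..D} \<times> C,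
      tail = (\<lambda>(i, c). (corner_vertex M c, Black)),
      head = (\<lambda>(i, c). (corner_vertex M
        (first_return (face_succ (color_submap M i)) (color_corner M i ` C) (color_corner M i c)),
        White))\<rparr>"

definition pairing :: "('v, 'h) cmap \<Rightarrow> ('v, 'h) corner set \<Rightarrow> ('v \<times> shade) set set" where
  "pairing M C = (\<lambda>v. {(v, Black), (v, White)}) ` marked_verts M C"

definition contract :: "('a, 'b) pre_digraph \<Rightarrow> 'a set set \<Rightarrow> ('a set, 'b) pre_digraph" where
  "contract G P =
     \<lparr>verts = P, arcs = arcs G,
      tail = (\<lambda>a. THE p. p \<in> P \<and> tail G a \<in> p),
      head = (\<lambda>a. THE p. p \<in> P \<and> head G a \<in> p)\<rparr>"

definition polychromatic_rank :: "nat \<Rightarrow> ('a, 'b) pre_digraph \<Rightarrow> ('b \<Rightarrow> nat) \<Rightarrow> int" where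
  "polychromatic_rank D G col =
     circuit_rank G - (\<Sum>i\<in>{1..D}. circuit_rank (color_part G col i))"


section \<open>External trees\<close>

text \<open>
  The components of the color-\<open>i\<close> submap with at least one marked vertex; they are trees
  whenever that submap is a forest.
\<close>

definition external_part :: "('v, 'h) cmap \<Rightarrow> ('v, 'h) corner set \<Rightarrow> nat \<Rightarrow> ('v, 'h) pre_digraph" where
  "external_part M C i = (let G = mgraph (color_submap M i) in
     G \<restriction> \<Union>{S \<in> components G. S \<inter> marked_verts M C \<noteq> {}})"

definition external_verts :: "nat \<Rightarrow> ('v, 'h) cmap \<Rightarrow> ('v, 'h) corner set \<Rightarrow> 'v set" where
  "external_verts D M C = (\<Union>i\<in>{1..D}. verts (external_part M C i))"

text \<open>All vertices are kept, only the edges of the external trees are removed.\<close>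

definition external_complement :: "nat \<Rightarrow> ('v, 'h) cmap \<Rightarrow> ('v, 'h) corner set \<Rightarrow> ('v, 'h) pre_digraph" where
  "external_complement D M C =
     (mgraph M)\<lparr>arcs := arcs (mgraph M) - (\<Union>i\<in>{1..D}. arcs (external_part M C i))\<rparr>"

end

theory Submission
  imports Defs
begin

text \<open>
  Write \<open>K\<^sub>i\<close>, \<open>L\<^sub>i\<close>, \<open>F\<^sub>i\<close> for the number of components, the
  circuit-rank and the number of faces of the color-\<open>i\<close> submap, and \<open>K\<^sub>i\<^sup>e\<close>, \<open>F\<^sub>i\<^sup>e\<close> for the numbers
  of those components and faces that meet a mark. A cycle of color \<open>i\<close> in the contracted boundary
  graph is a face of that submap meeting a mark, so its polychromatic rank is
  \<open>(D - 1) q + 1 - (\<Sum>i. F\<^sub>i\<^sup>e)\<close>. Let \<open>X\<^sub>i\<close> be the set of vertices of the components of color \<open>i\<close>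
  meeting a mark, \<open>X\<close> their union, \<open>Q\<close> the set of marked vertices, and let the graph of the
  remaining edges have \<open>K'\<close> components and circuit-rank \<open>L'\<close>, its color-\<open>i\<close> part having
  circuit-rank \<open>L'\<^sub>i\<close>. Counting the remaining edges in two ways expresses the difference of the
  two sides as \<open>(D - 2) (\<Sum>i. L\<^sub>i) + (\<Sum>i. K\<^sub>i + L\<^sub>i - F\<^sub>i)\<close> plus \<open>D\<close> times the sum of
  \<open>\<Sum>i. F\<^sub>i\<^sup>e - K\<^sub>i\<^sup>e\<close>, \<open>L' - (\<Sum>i. L'\<^sub>i)\<close>, \<open>(\<Sum>i. card (X\<^sub>i - Q)) - card (X - Q)\<close> and \<open>card X - K'\<close>.
  Every one of these terms is nonnegative: the second by Euler's inequality (the genus is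
  nonnegative), the fourth by superadditivity of the circuit-rank, and the last one because
  every component of the remaining graph meets \<open>X\<close> when the map is connected. If all
  \<open>L\<^sub>i\<close> vanish, each component has a single face, and only \<open>L'\<close> and the last two terms are left;
  their vanishing is what (ii) and (iii) say.
\<close>

section \<open>Circuit-rank of a multigraph\<close>

text \<open>The vertex set is not a parameter and the closure is reflexive on the whole type, so the
  edge set alone can vary in the inductions below; an isolated vertex forms its own class.\<close>

definition econn :: "('e \<Rightarrow> 'v) \<Rightarrow> ('e \<Rightarrow> 'v) \<Rightarrow> 'e set \<Rightarrow> ('v \<times> 'v) set" where
  "econn t h E = ((\<lambda>e. (t e, h e)) ` E \<union> (\<lambda>e. (h e, t e)) ` E)\<^sup>*"

definition conn_classes :: "'v set \<Rightarrow> ('e \<Rightarrow> 'v) \<Rightarrow> ('e \<Rightarrow> 'v) \<Rightarrow> 'e set \<Rightarrow> 'v set set" where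
  "conn_classes V t h E = (\<lambda>v. econn t h E `` {v}) ` V"

definition cyclomatic :: "'v set \<Rightarrow> ('e \<Rightarrow> 'v) \<Rightarrow> ('e \<Rightarrow> 'v) \<Rightarrow> 'e set \<Rightarrow> int" where
  "cyclomatic V t h E = int (card E) - int (card V) + int (card (conn_classes V t h E))"

lemma econn_refl [simp]: "(u, u) \<in> econn t h E"
  by (simp add: econn_def)

lemma econn_sym: "(u, v) \<in> econn t h E \<Longrightarrow> (v, u) \<in> econn t h E"
proof -
  have "sym ((\<lambda>e. (t e, h e)) ` E \<union> (\<lambda>e. (h e, t e)) ` E)"
    by (auto simp: sym_def)
  then show "(u, v) \<in> econn t h E \<Longrightarrow> (v, u) \<in> econn t h E"
    unfolding econn_def by (meson sym_rtrancl symD)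
qed

lemma econn_trans: "(u, v) \<in> econn t h E \<Longrightarrow> (v, w) \<in> econn t h E \<Longrightarrow> (u, w) \<in> econn t h E"
  unfolding econn_def by (rule rtrancl_trans)

lemma econn_edge: "e \<in> E \<Longrightarrow> (t e, h e) \<in> econn t h E"
  unfolding econn_def by (rule r_into_rtrancl) blast

lemma econn_mono: "E \<subseteq> F \<Longrightarrow> econn t h E \<subseteq> econn t h F"
  unfolding econn_def by (rule rtrancl_mono) blast

lemma econn_least:
  assumes "\<And>e. e \<in> E \<Longrightarrow> (t e, h e) \<in> R" "sym R" "trans R" "refl R"
  shows "econn t h E \<subseteq> R"
proof
  fix p assume "p \<in> econn t h E"
  then obtain u v where p: "p = (u, v)" and uv: "(u, v) \<in> econn t h E" by (cases p) auto
  from uv have "(u, v) \<in> R"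
    unfolding econn_def
  proof (induction rule: rtrancl_induct)
    case base
    then show ?case using assms(4) by (simp add: refl_on_def)
  next
    case (step y z)
    then have "(y, z) \<in> R" using assms(1,2) by (auto dest: symD)
    with step show ?case using assms(3) by (meson transD)
  qed
  with p show "p \<in> R" by simp
qed

lemma econn_subset_econn:
  assumes "\<And>e. e \<in> E \<Longrightarrow> (t e, h e) \<in> econn t' h' F"
  shows "econn t h E \<subseteq> econn t' h' F"
proof (rule econn_least[OF assms])
  show "sym (econn t' h' F)" by (rule symI) (rule econn_sym)
  show "trans (econn t' h' F)" by (rule transI) (rule econn_trans)
  show "refl (econn t' h' F)" by (simp add: refl_on_def)
qed

text \<open>The invariance relates the two ends of an edge by an equivalence, so it serves both
  directions of traversal.\<close>

lemma econn_induct [consumes 1, case_names base step]: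
  assumes "(u, v) \<in> econn t h E" "P u"
    and "\<And>e. e \<in> E \<Longrightarrow> P (t e) \<longleftrightarrow> P (h e)"
  shows "P v"
  using assms(1) unfolding econn_def
  by (induction rule: rtrancl_induct) (use assms(2,3) in auto)

lemma econn_class_eq_iff:
  "econn t h E `` {u} = econn t h E `` {v} \<longleftrightarrow> (u, v) \<in> econn t h E"
  by (auto intro: econn_sym econn_trans)

lemma econn_in_verts:
  assumes "\<And>e. e \<in> E \<Longrightarrow> t e \<in> V \<and> h e \<in> V" "(u, v) \<in> econn t h E" "u \<in> V"
  shows "v \<in> V"
  using assms(2,3) by (induction rule: econn_induct) (use assms(1) in auto)

lemma econn_class_subset:
  assumes "\<And>e. e \<in> E \<Longrightarrow> t e \<in> V \<and> h e \<in> V" "S \<in> conn_classes V t h E"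
  shows "S \<subseteq> V"
  using assms econn_in_verts[OF assms(1)] by (auto simp: conn_classes_def)

lemma conn_classes_eq_class:
  assumes "S \<in> conn_classes V t h E" "u \<in> S"
  shows "S = econn t h E `` {u}"
proof -
  obtain v where "S = econn t h E `` {v}" using assms(1) by (auto simp: conn_classes_def)
  moreover from this assms(2) have "(v, u) \<in> econn t h E" by simp
  ultimately show ?thesis by (simp add: econn_class_eq_iff)
qed

lemma econn_insert_connected:
  assumes "(t e, h e) \<in> econn t h E"
  shows "econn t h (insert e E) = econn t h E"
proof
  show "econn t h (insert e E) \<subseteq> econn t h E"
    by (rule econn_subset_econn) (use assms in \<open>auto intro: econn_edge\<close>)
qed (auto intro: econn_mono[THEN subsetD])

text \<open>The disjunction is invariant along every edge: a crossing of \<open>e\<close> switches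
  between its cases, and a second crossing leads back to an earlier one, so one use of
  \<open>e\<close> is enough.\<close>

lemma econn_insertD:
  assumes "(u, v) \<in> econn t h (insert e E)"
  shows "(u, v) \<in> econn t h E
    \<or> (u, t e) \<in> econn t h E \<and> (h e, v) \<in> econn t h E
    \<or> (u, h e) \<in> econn t h E \<and> (t e, v) \<in> econn t h E"
  using assms
proof (induction rule: econn_induct[where P = "\<lambda>v. (u, v) \<in> econn t h E
    \<or> (u, t e) \<in> econn t h E \<and> (h e, v) \<in> econn t h E
    \<or> (u, h e) \<in> econn t h E \<and> (t e, v) \<in> econn t h E"])
  case base
  then show ?case by simp
next
  case (step e')
  show ?case
  proof (cases "e' = e")
    case True
    then show ?thesis by (auto intro: econn_sym econn_trans)
  next
    case False
    with step have "(t e', h e') \<in> econn t h E" by (auto intro: econn_edge)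
    then show ?thesis by (meson econn_sym econn_trans)
  qed
qed

text \<open>The classes of the two ends merge into \<open>?U\<close>, which replaces them both, and
  all other classes stay the same.\<close>

lemma card_conn_classes_insert:
  assumes "finite V" "t e \<in> V" "h e \<in> V" "(t e, h e) \<notin> econn t h E"
  shows "card (conn_classes V t h E) = Suc (card (conn_classes V t h (insert e E)))"
proof -
  let ?c = "\<lambda>v. econn t h E `` {v}" and ?c' = "\<lambda>v. econn t h (insert e E) `` {v}"
  let ?U = "?c (t e) \<union> ?c (h e)"
  have edge: "(t e, h e) \<in> econn t h (insert e E)" by (rule econn_edge) simp
  have mono: "econn t h E \<subseteq> econn t h (insert e E)" by (rule econn_mono) blast
  have 1: "?c' v = ?U" if "v \<in> ?U" for v
  proof
    show "?c' v \<subseteq> ?U"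
      using that by (auto dest!: econn_insertD intro: econn_trans)
    show "?U \<subseteq> ?c' v"
      using that mono edge by (auto) (meson econn_sym econn_trans subsetD)+
  qed
  have 2: "?c' v = ?c v" if "v \<notin> ?U" for v
  proof
    show "?c' v \<subseteq> ?c v"
      using that by (auto dest!: econn_insertD intro: econn_sym)
    show "?c v \<subseteq> ?c' v" using mono by blast
  qed
  let ?K = "conn_classes V t h E"
  have K': "conn_classes V t h (insert e E) = insert ?U (?K - {?c (t e), ?c (h e)})"
  proof
    show "conn_classes V t h (insert e E) \<subseteq> insert ?U (?K - {?c (t e), ?c (h e)})"
    proof
      fix S assume "S \<in> conn_classes V t h (insert e E)"
      then obtain v where v: "v \<in> V" "S = ?c' v" by (auto simp: conn_classes_def)
      show "S \<in> insert ?U (?K - {?c (t e), ?c (h e)})"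
      proof (cases "v \<in> ?U")
        case True
        then show ?thesis using 1 v by simp
      next
        case False
        then have "?c v \<noteq> ?c (t e)" "?c v \<noteq> ?c (h e)"
          unfolding econn_class_eq_iff by (auto dest: econn_sym)
        then show ?thesis using 2[OF False] v by (auto simp: conn_classes_def)
      qed
    qed
    have "?U = ?c' (t e)" using 1[of "t e"] by simp
    then have "?U \<in> conn_classes V t h (insert e E)" using assms(2) by (simp add: conn_classes_def)
    moreover have "S \<in> conn_classes V t h (insert e E)" if S: "S \<in> ?K - {?c (t e), ?c (h e)}" for S
    proof -
      obtain v where v: "v \<in> V" "S = ?c v" using S by (auto simp: conn_classes_def)
      have "v \<notin> ?U" using S v econn_class_eq_iff[of t h E v] by (auto dest: econn_sym)
      then show ?thesis using 2 v by (auto simp: conn_classes_def)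
    qed
    ultimately show "insert ?U (?K - {?c (t e), ?c (h e)}) \<subseteq> conn_classes V t h (insert e E)"
      by blast
  qed
  have fin: "finite ?K" using assms(1) by (simp add: conn_classes_def)
  have in_K: "?c (t e) \<in> ?K" "?c (h e) \<in> ?K" using assms(2,3) by (auto simp: conn_classes_def)
  have ne: "?c (t e) \<noteq> ?c (h e)" unfolding econn_class_eq_iff by (rule assms(4))
  have notin: "?U \<notin> ?K - {?c (t e), ?c (h e)}"
  proof
    assume U: "?U \<in> ?K - {?c (t e), ?c (h e)}"
    then have "?U = ?c (t e)" by (intro conn_classes_eq_class) auto
    with U show False by blast
  qed
  have "card ?K \<ge> card {?c (t e), ?c (h e)}" using fin in_K by (intro card_mono) auto
  then have "card ?K \<ge> 2" using ne by simp
  moreover have "card (?K - {?c (t e), ?c (h e)}) = card ?K - 2"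
    using in_K ne fin by (subst card_Diff_subset) auto
  ultimately show ?thesis using K' notin fin by simp
qed

text \<open>An edge inside a class closes a cycle; an edge between two classes reduces their number
  by one, which offsets the additional edge.\<close>

lemma cyclomatic_insert:
  assumes "finite V" "finite E" "e \<notin> E" "t e \<in> V" "h e \<in> V"
  shows "cyclomatic V t h (insert e E)
    = cyclomatic V t h E + (if (t e, h e) \<in> econn t h E then 1 else 0)"
  using card_conn_classes_insert[where V = V and t = t and h = h and e = e and E = E] assms
  by (auto simp: cyclomatic_def econn_insert_connected conn_classes_def)

lemma conn_classes_empty: "conn_classes V t h {} = (\<lambda>v. {v}) ` V"
  by (simp add: conn_classes_def econn_def)

lemma cyclomatic_empty: "cyclomatic V t h {} = 0"
  by (simp add: cyclomatic_def conn_classes_empty card_image)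

text \<open>The edges of \<open>F\<close> are added one at a time: one that closes a cycle over a
  part of \<open>F\<close> also closes a cycle over that part together with \<open>E\<close>, so the
  right side grows at least as fast.\<close>

lemma cyclomatic_superadditive:
  assumes "finite V" "finite E" "finite F" "E \<inter> F = {}"
    and "\<And>e. e \<in> E \<union> F \<Longrightarrow> t e \<in> V \<and> h e \<in> V"
  shows "cyclomatic V t h E + cyclomatic V t h F \<le> cyclomatic V t h (E \<union> F)"
  using assms(3,4,5)
proof (induction F rule: finite_induct)
  case empty
  then show ?case by (simp add: cyclomatic_empty)
next
  case (insert e F)
  have "cyclomatic V t h E + cyclomatic V t h F \<le> cyclomatic V t h (E \<union> F)"
    using insert by auto
  moreover have "econn t h F \<subseteq> econn t h (E \<union> F)" by (rule econn_mono) blast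
  moreover have "cyclomatic V t h (insert e F)
      = cyclomatic V t h F + (if (t e, h e) \<in> econn t h F then 1 else 0)"
    using insert assms(1) by (intro cyclomatic_insert) auto
  moreover have "cyclomatic V t h (insert e (E \<union> F))
      = cyclomatic V t h (E \<union> F) + (if (t e, h e) \<in> econn t h (E \<union> F) then 1 else 0)"
    using insert assms(1,2) by (intro cyclomatic_insert) auto
  ultimately show ?case by auto
qed

lemma cyclomatic_nonneg:
  assumes "finite V" "finite E" "\<And>e. e \<in> E \<Longrightarrow> t e \<in> V \<and> h e \<in> V"
  shows "0 \<le> cyclomatic V t h E"
  using assms(2,3)
  by (induction E rule: finite_induct) (auto simp: cyclomatic_empty cyclomatic_insert assms(1))

text \<open>Superadditivity is applied to \<open>E\<close> and \<open>F - E\<close>, the latter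
  having nonnegative rank.\<close>

lemma cyclomatic_mono:
  assumes "finite V" "finite F" "E \<subseteq> F" "\<And>e. e \<in> F \<Longrightarrow> t e \<in> V \<and> h e \<in> V"
  shows "cyclomatic V t h E \<le> cyclomatic V t h F"
proof -
  have fin: "finite E" "finite (F - E)" using assms(2,3) finite_subset by auto
  have "E \<union> (F - E) = F" using assms(3) by blast
  then have "cyclomatic V t h E + cyclomatic V t h (F - E) \<le> cyclomatic V t h F"
    using cyclomatic_superadditive[of V E "F - E" t h] assms fin by auto
  moreover have "0 \<le> cyclomatic V t h (F - E)"
    using assms fin by (intro cyclomatic_nonneg) auto
  ultimately show ?thesis by simp
qed

lemma sum_cyclomatic_le:
  assumes "finite V" "finite I" "\<And>i. i \<in> I \<Longrightarrow> finite (E i)"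
    and "\<And>i j. i \<in> I \<Longrightarrow> j \<in> I \<Longrightarrow> i \<noteq> j \<Longrightarrow> E i \<inter> E j = {}"
    and "\<And>i e. i \<in> I \<Longrightarrow> e \<in> E i \<Longrightarrow> t e \<in> V \<and> h e \<in> V"
  shows "(\<Sum>i\<in>I. cyclomatic V t h (E i)) \<le> cyclomatic V t h (\<Union>i\<in>I. E i)"
  using assms(2-5)
proof (induction I rule: finite_induct)
  case empty
  then show ?case by (simp add: cyclomatic_empty)
next
  case (insert i I)
  have "(\<Sum>i\<in>I. cyclomatic V t h (E i)) \<le> cyclomatic V t h (\<Union>i\<in>I. E i)"
    by (rule insert.IH) (use insert.prems in blast)+
  moreover have "cyclomatic V t h (E i) + cyclomatic V t h (\<Union>i\<in>I. E i)
      \<le> cyclomatic V t h (E i \<union> (\<Union>i\<in>I. E i))"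
  proof (rule cyclomatic_superadditive[OF assms(1)])
    show "E i \<inter> \<Union> (E ` I) = {}" using insert by blast
    show "finite (\<Union> (E ` I))" using insert by auto
    show "t e \<in> V \<and> h e \<in> V" if "e \<in> E i \<union> \<Union> (E ` I)" for e
      using that insert.prems(3) by blast
  qed (use insert in auto)
  ultimately show ?case using insert by simp
qed

text \<open>Removing an edge lowers the rank exactly when it is not a bridge. If all edges are
  bridges, they remain so in every smaller edge set, and the rank vanishes by induction.\<close>

lemma cyclomatic_eq_0_iff:
  assumes "finite V" "finite E" "\<And>e. e \<in> E \<Longrightarrow> t e \<in> V \<and> h e \<in> V"
  shows "cyclomatic V t h E = 0 \<longleftrightarrow> (\<forall>e\<in>E. (t e, h e) \<notin> econn t h (E - {e}))"
  using assms(2,3)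
proof (induction "card E" arbitrary: E rule: less_induct)
  case less
  have ins: "cyclomatic V t h E
      = cyclomatic V t h (E - {e}) + (if (t e, h e) \<in> econn t h (E - {e}) then 1 else 0)"
    if "e \<in> E" for e
    using cyclomatic_insert[OF assms(1), of "E - {e}" e t h] less.prems that
    by (simp add: insert_absorb)
  have nonneg: "0 \<le> cyclomatic V t h (E - {e})" for e
    using less.prems by (intro cyclomatic_nonneg assms(1)) auto
  show ?case
  proof
    assume 0: "cyclomatic V t h E = 0"
    show "\<forall>e\<in>E. (t e, h e) \<notin> econn t h (E - {e})"
    proof
      fix e assume "e \<in> E"
      with ins[OF this] nonneg[of e] 0 show "(t e, h e) \<notin> econn t h (E - {e})"
        by (auto split: if_splits)
    qed
  next
    assume bridges: "\<forall>e\<in>E. (t e, h e) \<notin> econn t h (E - {e})"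
    show "cyclomatic V t h E = 0"
    proof (cases "E = {}")
      case True
      then show ?thesis by (simp add: cyclomatic_empty)
    next
      case False
      then obtain e where e: "e \<in> E" by blast
      have "(t f, h f) \<notin> econn t h (E - {e} - {f})" if "f \<in> E" for f
        using bridges that econn_mono[of "E - {e} - {f}" "E - {f}" t h] by blast
      then have "cyclomatic V t h (E - {e}) = 0"
        using less.hyps[of "E - {e}"] less.prems card_Diff1_less[OF less.prems(1) e] by auto
      then show ?thesis using ins[OF e] bridges e by simp
    qed
  qed
qed

section \<open>Library components, connectedness and forests in terms of edge sets\<close>

context wf_digraph
begin

text \<open>The condition on \<open>u\<close> appears because library reachability is confined to
  the vertices, while \<open>econn\<close> is reflexive everywhere.\<close>

lemma reachable_mk_symmetric_iff:
  "u \<rightarrow>\<^sup>*\<^bsub>mk_symmetric G\<^esub> v \<longleftrightarrow> u \<in> verts G \<and> (u, v) \<in> econn (tail G) (head G) (arcs G)"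
proof -
  interpret S: pair_wf_digraph "mk_symmetric G" by (rule wellformed_mk_symmetric)
  have arcs: "parcs (mk_symmetric G)
      = (\<lambda>e. (tail G e, head G e)) ` arcs G \<union> (\<lambda>e. (head G e, tail G e)) ` arcs G"
    by (auto simp: parcs_mk_symmetric)
  show ?thesis
    using S.reachable_conv'[of u v] S.reachable_in_verts(1)[of u v]
    unfolding with_proj_simps arcs pverts_mk_symmetric econn_def by blast
qed

lemma in_verts_econn: "u \<in> verts G \<Longrightarrow> (u, v) \<in> econn (tail G) (head G) (arcs G) \<Longrightarrow> v \<in> verts G"
  by (rule econn_in_verts[of "arcs G"]) auto

text \<open>The library describes a component as a nonempty set of mutually reachable vertices such
  that no outside vertex is mutually reachable with a member. By symmetry of \<open>econn\<close>
  these sets are its equivalence classes.\<close>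

lemma components_eq_conn_classes:
  "components G = conn_classes (verts G) (tail G) (head G) (arcs G)" (is "?C = ?K")
proof -
  let ?R = "econn (tail G) (head G) (arcs G)"
  have comp: "S \<in> ?C \<longleftrightarrow> S \<noteq> {}
      \<and> (\<forall>u\<in>S. \<forall>v\<in>S. u \<in> verts G \<and> (u, v) \<in> ?R)
      \<and> (\<forall>u\<in>S. \<forall>v. v \<notin> S \<longrightarrow> \<not> (u \<in> verts G \<and> (u, v) \<in> ?R) \<or> \<not> (v \<in> verts G \<and> (v, u) \<in> ?R))" for S
    by (simp add: components_def pre_digraph.sccs_verts_def reachable_mk_symmetric_iff)
  show ?thesis
  proof (intro set_eqI iffI)
    fix S assume S: "S \<in> ?C"
    then obtain u where u: "u \<in> S" using comp by auto
    then have "u \<in> verts G" using S comp by blast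
    moreover have "S = ?R `` {u}"
    proof
      show "S \<subseteq> ?R `` {u}" using S u comp by blast
      show "?R `` {u} \<subseteq> S"
      proof
        fix v assume v: "v \<in> ?R `` {u}"
        then have "v \<in> verts G" "(v, u) \<in> ?R"
          using \<open>u \<in> verts G\<close> by (auto intro: econn_sym in_verts_econn)
        moreover have "v \<notin> S \<Longrightarrow> \<not> (u \<in> verts G \<and> (u, v) \<in> ?R) \<or> \<not> (v \<in> verts G \<and> (v, u) \<in> ?R)"
          using S u unfolding comp by simp
        ultimately show "v \<in> S" using v \<open>u \<in> verts G\<close> by blast
      qed
    qed
    ultimately show "S \<in> ?K" by (auto simp: conn_classes_def)
  next
    fix S assume "S \<in> ?K"
    then obtain w where w: "w \<in> verts G" "S = ?R `` {w}" by (auto simp: conn_classes_def)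
    have wu: "(w, u) \<in> ?R" if "u \<in> S" for u using that w(2) by simp
    have "u \<in> verts G" if "u \<in> S" for u by (rule in_verts_econn[OF w(1) wu[OF that]])
    moreover have "S = ?R `` {u}" if "u \<in> S" for u
      using w(2) wu[OF that] by (simp only: econn_class_eq_iff)
    moreover have "S \<noteq> {}" using w(2) econn_refl by fast
    ultimately show "S \<in> ?C" unfolding comp by blast
  qed
qed

lemma connected_iff_econn:
  "connected G \<longleftrightarrow> verts G \<noteq> {} \<and> (\<forall>u\<in>verts G. \<forall>v\<in>verts G. (u, v) \<in> econn (tail G) (head G) (arcs G))"
  by (auto simp: connected_def strongly_connected_def reachable_mk_symmetric_iff)

lemma cas_imp_econn:
  assumes "cas x p y" "\<And>a. a \<in> set p \<Longrightarrow> (tail G a, head G a) \<in> econn t h E"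
  shows "(x, y) \<in> econn t h E"
  using assms
proof (induction p arbitrary: x)
  case (Cons a p)
  then have "(head G a, y) \<in> econn t h E" by auto
  then show ?case using Cons.prems by (auto intro: econn_trans)
qed simp

text \<open>If an edge were used again further along, in either direction, the vertex where it was
  first left would be visited again, which an \<open>apath\<close> excludes.\<close>

lemma apath_distinct_edges:
  assumes "apath u p v"
    and "\<And>a. a \<in> arcs G \<Longrightarrow> tail G (r a) = head G a"
  shows "distinct (map (\<lambda>a. {a, r a}) p)"
  using assms(1)
proof (induction p arbitrary: u)
  case (Cons b p)
  have path: "apath (head G b) p v" and notin: "tail G b \<notin> set (awalk_verts (head G b) p)"
    using Cons.prems by (auto simp: apath_Cons_iff)
  have "{b, r b} \<noteq> {c, r c}" if c: "c \<in> set p" for c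
  proof
    have "set p \<subseteq> arcs G" "cas (head G b) p v" using path by (auto simp: apath_def awalk_def)
    have "tail G c \<in> set (awalk_verts (head G b) p)"
      using c by (auto simp: awalk_verts_conv)
    moreover have "head G c \<in> set (awalk_verts (head G b) p)"
      using c awalk_verts_conv'[OF \<open>cas (head G b) p v\<close>] by auto
    moreover assume "{b, r b} = {c, r c}"
    then have "b = c \<or> b = r c" by (auto simp: doubleton_eq_iff)
    ultimately show False using notin assms(2) c \<open>set p \<subseteq> arcs G\<close> by auto
  qed
  then show ?case using Cons.IH[OF path] by auto
qed simp

text \<open>Both sides say that every edge is a bridge. The rest of a cycle with distinct edges
  joins the ends of any one of them; conversely, a path that joins the ends of an edge without using
  it closes up to such a cycle.\<close>

lemma bidirected_forest_iff_cyclomatic: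
  assumes "finite (verts G)" "finite (arcs G)"
    and arcs: "arcs G = R \<union> r ` R" "R \<inter> r ` R = {}"
    and r: "\<And>a. a \<in> arcs G \<Longrightarrow> r (r a) = a" "\<And>a. a \<in> arcs G \<Longrightarrow> tail G (r a) = head G a"
  shows "bidirected_forest G r \<longleftrightarrow> cyclomatic (verts G) (tail G) (head G) R = 0"
proof -
  have r_arcs: "r a \<in> arcs G" if "a \<in> arcs G" for a using that arcs(1) r(1) by auto
  have head_r: "head G (r a) = tail G a" if "a \<in> arcs G" for a
    using r[OF r_arcs[OF that]] r[OF that] by metis
  have fin: "finite R" using assms(2) arcs(1) by simp
  have "(\<forall>e\<in>R. (tail G e, head G e) \<notin> econn (tail G) (head G) (R - {e}))
      \<longleftrightarrow> bidirected_forest G r"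
  proof
    assume bridges: "\<forall>e\<in>R. (tail G e, head G e) \<notin> econn (tail G) (head G) (R - {e})"
    show "bidirected_forest G r"
      unfolding bidirected_forest_def
    proof
      assume "\<exists>p. cycle p \<and> distinct (map (\<lambda>a. {a, r a}) p)"
      then obtain p u where p: "awalk u p u" "p \<noteq> []" "distinct (map (\<lambda>a. {a, r a}) p)"
        by (auto simp: cycle_def)
      then obtain a p' where ap: "p = a # p'" by (cases p) auto
      have a: "a \<in> arcs G" and p': "set p' \<subseteq> arcs G" "cas (head G a) p' (tail G a)"
        using p(1) unfolding ap by (auto simp: awalk_def)
      \<comment> \<open>This is the half in \<open>R\<close> of the edge of \<open>a\<close>,
        whichever way the cycle runs through it.\<close>
      define e where "e = (if a \<in> R then a else r a)"
      have e: "e \<in> R" using a arcs r(1) unfolding e_def by auto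
      have "(head G a, tail G a) \<in> econn (tail G) (head G) (R - {e})"
      proof (rule cas_imp_econn[OF p'(2)])
        fix c assume c: "c \<in> set p'"
        have ne: "{a, r a} \<noteq> {c, r c}" using p(3) c unfolding ap by auto
        have cG: "c \<in> arcs G" using c p' by blast
        show "(tail G c, head G c) \<in> econn (tail G) (head G) (R - {e})"
        proof (cases "c \<in> R")
          case True
          have "c \<noteq> e" using ne r(1)[OF a] unfolding e_def by (auto split: if_splits)
          with True show ?thesis by (auto intro: econn_edge)
        next
          case False
          then have rc: "r c \<in> R" using cG arcs r(1) by auto
          have "r c \<noteq> e"
          proof
            assume "r c = e"
            then have "r c = a \<or> r c = r a" unfolding e_def by presburger
            then show False using ne r(1)[OF a] r(1)[OF cG] by (metis insert_commute)
          qed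
          with rc have "(tail G (r c), head G (r c)) \<in> econn (tail G) (head G) (R - {e})"
            by (auto intro: econn_edge)
          then show ?thesis using cG r head_r by (simp add: econn_sym)
        qed
      qed
      then have "(tail G e, head G e) \<in> econn (tail G) (head G) (R - {e})"
        using a r head_r unfolding e_def by (auto intro: econn_sym)
      with bridges e show False by blast
    qed
  next
    assume forest: "bidirected_forest G r"
    show "\<forall>e\<in>R. (tail G e, head G e) \<notin> econn (tail G) (head G) (R - {e})"
    proof (intro ballI notI)
      fix e assume e: "e \<in> R"
        and conn: "(tail G e, head G e) \<in> econn (tail G) (head G) (R - {e})"
      have eG: "e \<in> arcs G" using e arcs by blast
      \<comment> \<open>Both halves of the edge are deleted, so a path in \<open>H\<close> cannot
        use it in either direction.\<close>
      define H where "H = G\<lparr>arcs := arcs G - {e, r e}\<rparr>"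
      interpret H: wf_digraph H by unfold_locales (auto simp: H_def)
      have sub: "subgraph H G"
        unfolding subgraph_def compatible_def
        by (auto simp: H_def[symmetric] intro: H.wf_digraph_axioms wf_digraph_axioms)
          (auto simp: H_def)
      have H_simps: "verts H = verts G" "tail H = tail G" "head H = head G"
        "arcs H = arcs G - {e, r e}" by (simp_all add: H_def)
      have "head G e \<rightarrow>\<^sup>*\<^bsub>H\<^esub> tail G e"
        using econn_sym[OF conn]
      proof (induction rule: econn_induct)
        case base
        then show ?case using eG H_simps by simp
      next
        case (step c)
        have cG: "c \<in> arcs G" "r c \<in> arcs G" using step arcs by auto
        have "c \<noteq> r e" using step e arcs(2) by auto
        moreover have "r c \<noteq> e" using step e arcs(2) by auto
        moreover have "r c \<noteq> r e" using step r(1)[OF cG(1)] r(1)[OF eG] by auto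
        ultimately have "c \<in> arcs H" "r c \<in> arcs H" using step cG H_simps by auto
        then have "tail G c \<rightarrow>\<^bsub>H\<^esub> head G c" "head G c \<rightarrow>\<^bsub>H\<^esub> tail G c"
          using cG r head_r H_simps by (metis H.in_arcs_imp_in_arcs_ends)+
        then show ?case by (meson H.reachable_adj_trans)
      qed
      \<comment> \<open>Passing to a path without repeated vertices is what makes its edges
        distinct.\<close>
      then obtain p where p: "H.apath (head G e) p (tail G e)" by (auto simp: H.reachable_apath)
      then have pG: "apath (head G e) p (tail G e)" using sub by (rule subgraph_apath_imp_apath)
      have "set p \<subseteq> arcs H" using p by (auto simp: H.apath_def H.awalk_def)
      then have "{e, r e} \<noteq> {c, r c}" if "c \<in> set p" for c using that H_simps by auto
      then have "distinct (map (\<lambda>a. {a, r a}) (e # p))"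
        using apath_distinct_edges[OF pG, of r] r(2) by auto
      moreover have "cycle (e # p)"
        using pG eG by (auto simp: cycle_def apath_def awalk_Cons_iff)
      ultimately show False using forest by (auto simp: bidirected_forest_def)
    qed
  qed
  moreover have "tail G e \<in> verts G \<and> head G e \<in> verts G" if "e \<in> R" for e
    using that arcs(1) by auto
  ultimately show ?thesis
    using cyclomatic_eq_0_iff[OF assms(1) fin, of "tail G" "head G"] by simp
qed

end

section \<open>Permutations\<close>

text \<open>Since \<open>x\<close> lies in \<open>T\<close> and on its own orbit, the orbit comes
  back to \<open>T\<close>, and the \<open>LEAST\<close> in \<open>first_return\<close> is
  attained.\<close>

lemma first_returnE:
  assumes "permutation f" "x \<in> T"
  obtains k where "0 < k" "first_return f T x = (f ^^ k) x" "(f ^^ k) x \<in> T"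
    "\<And>j. 0 < j \<Longrightarrow> j < k \<Longrightarrow> (f ^^ j) x \<notin> T"
proof -
  let ?P = "\<lambda>k. 0 < k \<and> (f ^^ k) x \<in> T"
  have "x \<in> orbit f x" by (rule permutation_self_in_orbit[OF assms(1)])
  then obtain n where "0 < n" "(f ^^ n) x = x" by (auto simp: orbit_altdef)
  then have "?P n" using assms(2) by simp
  then have "?P (LEAST k. ?P k)" by (rule LeastI)
  moreover have "\<not> ?P j" if "j < (LEAST k. ?P k)" for j using that by (rule not_less_Least)
  ultimately show thesis by (intro that[of "LEAST k. ?P k"]) (auto simp: first_return_def)
qed

lemma first_return_in: "permutation f \<Longrightarrow> x \<in> T \<Longrightarrow> first_return f T x \<in> T"
  by (metis first_returnE)

text \<open>A point of \<open>T\<close> reached after \<open>n\<close> steps of \<open>f\<close> is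
  either the first return or is reached from it in fewer steps. Only the values of \<open>g\<close>
  on \<open>T\<close> are prescribed, so extensions by the identity qualify.\<close>

lemma orbit_first_return:
  assumes "permutation f" "x \<in> T" and g: "\<And>x. x \<in> T \<Longrightarrow> g x = first_return f T x"
  shows "orbit g x = orbit f x \<inter> T"
proof
  have step: "g y \<in> orbit f y \<inter> T" if "y \<in> T" for y
  proof (rule first_returnE[OF assms(1) that])
    fix k assume "0 < k" "first_return f T y = (f ^^ k) y" "(f ^^ k) y \<in> T"
    then show ?thesis using g[OF that] by (auto simp: orbit_altdef)
  qed
  show "orbit g x \<subseteq> orbit f x \<inter> T"
  proof
    fix y assume "y \<in> orbit g x"
    then show "y \<in> orbit f x \<inter> T"
    proof induction
      case base
      then show ?case by (rule step[OF assms(2)])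
    next
      case (step y)
      then show ?case using \<open>\<And>y. y \<in> T \<Longrightarrow> g y \<in> orbit f y \<inter> T\<close>[of y]
        by (auto intro: orbit_trans)
    qed
  qed
  have "(f ^^ n) x \<in> orbit g x" if "0 < n" "(f ^^ n) x \<in> T" for n
    using that assms(2)
  proof (induction n arbitrary: x rule: less_induct)
    case (less n)
    obtain k where k: "0 < k" "first_return f T x = (f ^^ k) x" "(f ^^ k) x \<in> T"
      "\<And>j. 0 < j \<Longrightarrow> j < k \<Longrightarrow> (f ^^ j) x \<notin> T"
      using first_returnE[OF assms(1) less.prems(3)] by metis
    have gx: "g x = (f ^^ k) x" using g k(2) less.prems(3) by simp
    have "k \<le> n" using k(4)[of n] less.prems by force
    show ?case
    proof (cases "k = n")
      case True
      then show ?thesis using gx by (metis orbit.base)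
    next
      case False
      with \<open>k \<le> n\<close> have "0 < n - k" "n - k < n" using k(1) by auto
      have eq: "(f ^^ (n - k)) (g x) = (f ^^ n) x"
        using funpow_add[of "n - k" k f] \<open>k \<le> n\<close> by (simp add: gx)
      have "g x \<in> T" using k(3) by (simp only: gx)
      moreover have "(f ^^ (n - k)) (g x) \<in> T" using less.prems(2) by (simp only: eq)
      ultimately have "(f ^^ (n - k)) (g x) \<in> orbit g (g x)"
        using less.IH[OF \<open>n - k < n\<close> \<open>0 < n - k\<close>] by blast
      then have "(f ^^ n) x \<in> orbit g (g x)" by (simp only: eq)
      then show ?thesis by (rule orbit_subset)
    qed
  qed
  then show "orbit f x \<inter> T \<subseteq> orbit g x" by (auto simp: orbit_altdef)
qed

text \<open>Each \<open>x\<close> in \<open>T\<close> lies on its own orbit under the map, and the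
  last step of that orbit exhibits \<open>x\<close> as an image; on a finite set, surjectivity gives
  injectivity.\<close>

lemma first_return_permutes:
  assumes "permutation f" "finite T"
  shows "(\<lambda>x. if x \<in> T then first_return f T x else x) permutes T" (is "?g permutes T")
proof -
  have in_T: "?g ` T \<subseteq> T" using first_return_in[OF assms(1)] by auto
  have "T \<subseteq> ?g ` T"
  proof
    fix x assume x: "x \<in> T"
    then have "x \<in> orbit ?g x"
      using orbit_first_return[OF assms(1) x, of ?g] permutation_self_in_orbit[OF assms(1)] by simp
    then show "x \<in> ?g ` T"
    proof cases
      case base
      then show ?thesis using x by (rule image_eqI)
    next
      case (step y)
      then have "y \<in> T" using orbit_first_return[OF assms(1) x, of ?g] by auto
      show ?thesis using step(1) \<open>y \<in> T\<close> by (rule image_eqI)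
    qed
  qed
  with in_T have surj: "?g ` T = T" by (rule subset_antisym)
  have "inj_on ?g T" by (rule eq_card_imp_inj_on[OF assms(2)]) (simp only: surj)
  with surj have "bij_betw ?g T T" by (simp only: bij_betw_def)
  then show ?thesis by (rule bij_imp_permutes) simp
qed

lemma orbit_eq_iff:
  assumes "permutation f"
  shows "orbit f x = orbit f y \<longleftrightarrow> y \<in> orbit f x"
proof
  assume "orbit f x = orbit f y"
  then show "y \<in> orbit f x" using permutation_self_in_orbit[OF assms, of y] by simp
next
  assume "y \<in> orbit f x"
  from orbit_cyclic_eq3[OF cyclic_on_orbit'[OF assms] this] show "orbit f x = orbit f y" by simp
qed

text \<open>The orbit of \<open>a\<close> is followed unchanged until it would close up; at that
  moment the transposition sends it to \<open>b\<close> instead.\<close>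

lemma transpose_joins_orbits:
  assumes "permutation f" "b \<notin> orbit f a"
  shows "b \<in> orbit (transpose a b \<circ> f) a"
proof -
  let ?g = "transpose a b \<circ> f"
  obtain k where k: "0 < k" "(f ^^ k) a = a" "\<And>j. 0 < j \<Longrightarrow> j < k \<Longrightarrow> (f ^^ j) a \<noteq> a"
    using first_returnE[OF assms(1), of a "{a}"] by auto
  have "(?g ^^ j) a = (f ^^ j) a" if "j < k" for j
    using that
  proof (induction j)
    case (Suc j)
    have "(f ^^ Suc j) a \<noteq> a" using k(3) Suc.prems by blast
    moreover have "(f ^^ Suc j) a \<in> orbit f a" unfolding orbit_altdef by blast
    then have "(f ^^ Suc j) a \<noteq> b" using assms(2) by metis
    ultimately show ?case using Suc by (simp add: transpose_def)
  qed simp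
  moreover obtain k' where k': "k = Suc k'" using k(1) gr0_conv_Suc by blast
  ultimately have "(?g ^^ k') a = (f ^^ k') a" by blast
  then have "(?g ^^ k) a = transpose a b ((f ^^ k) a)" unfolding k' by simp
  also have "\<dots> = b" using k(2) by simp
  finally show ?thesis using k(1) unfolding orbit_altdef by (metis (mono_tags, lifting) mem_Collect_eq)
qed

text \<open>An orbit of the new map that avoids \<open>a\<close> and \<open>b\<close> is an orbit of
  \<open>f\<close>, so only the orbits through these two points matter. The new map has at most two
  of them and \<open>f\<close> at least one; if \<open>f\<close> has two, they are merged into
  one.\<close>

lemma card_orbits_transpose:
  assumes f: "f permutes S" and "finite S" "a \<in> S" "b \<in> S"
  shows "card (orbit (transpose a b \<circ> f) ` S) \<le> Suc (card (orbit f ` S))"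
    and "b \<notin> orbit f a \<Longrightarrow> Suc (card (orbit (transpose a b \<circ> f) ` S)) \<le> card (orbit f ` S)"
proof -
  let ?g = "transpose a b \<circ> f"
  have g: "?g permutes S"
    using f assms(3,4) by (intro permutes_compose permutes_swap_id)
  have perm: "permutation f" "permutation ?g"
    using f g assms(2) by (auto simp: permutation_permutes)
  define U where "U = {o' \<in> orbit f ` S. a \<notin> o' \<and> b \<notin> o'}"
  have "orbit ?g x \<in> U" if x: "x \<in> S" "a \<notin> orbit ?g x" "b \<notin> orbit ?g x" for x
  proof -
    have "f s = ?g s" if "s \<in> orbit ?g x" for s
    proof -
      have "?g s \<in> orbit ?g x" using that by (rule orbit.step)
      then have "?g s \<noteq> a" "?g s \<noteq> b" using x by auto
      then show ?thesis by (auto simp: transpose_def split: if_splits)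
    qed
    then have "orbit f x = orbit ?g x"
      by (intro orbit_cong permutation_self_in_orbit perm)
    then show ?thesis using x unfolding U_def by (metis (mono_tags, lifting) image_eqI mem_Collect_eq)
  qed
  moreover have "orbit ?g x = orbit ?g y" if "y \<in> orbit ?g x" for x y
    using that orbit_eq_iff[OF perm(2)] by simp
  ultimately have "orbit ?g ` S \<subseteq> U \<union> {orbit ?g a, orbit ?g b}" by blast
  moreover have finU: "finite U" using assms(2) by (simp add: U_def)
  ultimately have "card (orbit ?g ` S) \<le> card (U \<union> {orbit ?g a, orbit ?g b})"
    by (intro card_mono) auto
  also have "\<dots> \<le> card U + card {orbit ?g a, orbit ?g b}" by (rule card_Un_le)
  finally have le_g: "card (orbit ?g ` S) \<le> card U + card {orbit ?g a, orbit ?g b}" .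
  have "a \<in> orbit f a" "b \<in> orbit f b" by (rule permutation_self_in_orbit[OF perm(1)])+
  then have "U \<inter> {orbit f a, orbit f b} = {}" unfolding U_def by auto
  then have "card U + card {orbit f a, orbit f b} = card (U \<union> {orbit f a, orbit f b})"
    using finU by (intro card_Un_disjoint[symmetric]) auto
  also have "\<dots> \<le> card (orbit f ` S)"
    using assms by (intro card_mono) (auto simp: U_def)
  finally have ge_f: "card U + card {orbit f a, orbit f b} \<le> card (orbit f ` S)" .
  have "card {orbit ?g a, orbit ?g b} \<le> 2" "1 \<le> card {orbit f a, orbit f b}"
    by (auto simp: card_insert_if)
  then show "card (orbit ?g ` S) \<le> Suc (card (orbit f ` S))" using le_g ge_f by linarith
  assume b: "b \<notin> orbit f a"
  then have "card {orbit f a, orbit f b} = 2"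
    using orbit_eq_iff[OF perm(1)] by auto
  moreover have "orbit ?g a = orbit ?g b"
    using transpose_joins_orbits[OF perm(1) b] orbit_eq_iff[OF perm(2)] by simp
  ultimately show "Suc (card (orbit ?g ` S)) \<le> card (orbit f ` S)" using le_g ge_f by simp
qed

section \<open>Euler's inequality for combinatorial maps\<close>

context colored_map
begin

lemma permutation_esucc: "permutation (esucc M)"
  unfolding permutation_permutes using esucc_permutes finite_arcs by blast

lemma orbit_esucc: "a \<in> arcs (mgraph M) \<Longrightarrow> orbit (esucc M) a = out_arcs (mgraph M) (tail (mgraph M) a)"
  by (rule orbit_cyclic_eq3[OF esucc_cyclic]) auto

lemma esucc_in_arcs [simp]: "esucc M a \<in> arcs (mgraph M) \<longleftrightarrow> a \<in> arcs (mgraph M)"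
  using esucc_permutes by (rule permutes_in_image)

lemma tail_esucc [simp]: "a \<in> arcs (mgraph M) \<Longrightarrow> tail (mgraph M) (esucc M a) = tail (mgraph M) a"
  using orbit.base[of "esucc M" a] orbit_esucc[of a] by simp

lemma color_submap_simps:
  "verts (mgraph (color_submap M i)) = verts (mgraph M)"
  "arcs (mgraph (color_submap M i)) = {a \<in> arcs (mgraph M). ecol M a = i}"
  "tail (mgraph (color_submap M i)) = tail (mgraph M)"
  "head (mgraph (color_submap M i)) = head (mgraph M)"
  "ecol (color_submap M i) = ecol M"
  "erev (color_submap M i) = (\<lambda>a. if a \<in> {a \<in> arcs (mgraph M). ecol M a = i} then erev M a else a)"
  "esucc (color_submap M i) = (\<lambda>a. if a \<in> {a \<in> arcs (mgraph M). ecol M a = i}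
     then first_return (esucc M) {a \<in> arcs (mgraph M). ecol M a = i} a else a)"
  by (simp_all add: color_submap_def color_part_def Let_def)

text \<open>The order around a vertex stays cyclic because the orbits of a first-return map are the
  traces of the original orbits, here on the half-edges of color \<open>i\<close>.\<close>

lemma colored_map_color_submap: "colored_map D (color_submap M i)"
proof -
  let ?N = "color_submap M i" and ?A = "{a \<in> arcs (mgraph M). ecol M a = i}"
  have "fin_digraph (mgraph ?N)"
    by unfold_locales (auto simp: color_submap_simps)
  moreover have "bidirected_digraph (mgraph ?N) (erev ?N)"
    by unfold_locales (auto simp: color_submap_simps ecol_erev arev_neq)
  moreover have "colored_map_axioms D ?N"
  proof
    show "esucc ?N permutes arcs (mgraph ?N)"
      unfolding color_submap_simps
      by (rule first_return_permutes[OF permutation_esucc]) simp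
    fix v assume "v \<in> verts (mgraph ?N)" "out_arcs (mgraph ?N) v \<noteq> {}"
    then obtain a where a: "a \<in> out_arcs (mgraph ?N) v" by blast
    then have av: "a \<in> arcs (mgraph M)" "tail (mgraph M) a = v" by (auto simp: color_submap_simps)
    have "orbit (esucc ?N) a = orbit (esucc M) a \<inter> ?A"
      by (rule orbit_first_return[OF permutation_esucc])
        (use a in \<open>auto simp: color_submap_simps\<close>)
    also have "\<dots> = out_arcs (mgraph ?N) v"
      unfolding orbit_esucc[OF av(1)] av(2) by (auto simp: color_submap_simps)
    finally show "cyclic_on (esucc ?N) (out_arcs (mgraph ?N) v)"
      by (intro cyclic_on_singleI[OF a]) simp
  qed (auto simp: color_submap_simps ecol_erev dest: ecol_range)
  ultimately show ?thesis by (simp add: colored_map_def)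
qed

lemma corner_vertex_color_submap [simp]: "corner_vertex (color_submap M i) c = corner_vertex M c"
  by (cases c) (simp_all add: color_submap_simps)

lemma corner_vertex_in_verts: "c \<in> corners M \<Longrightarrow> corner_vertex M c \<in> verts (mgraph M)"
  by (auto simp: corners_def)

text \<open>The half-edges at a vertex form one orbit of \<open>esucc\<close>, hence of its inverse,
  so walking back clockwise meets color \<open>i\<close> whenever that color occurs at the
  vertex.\<close>

lemma color_corner:
  assumes "c \<in> corners M"
  shows "color_corner M i c \<in> corners (color_submap M i)"
    and "corner_vertex M (color_corner M i c) = corner_vertex M c"
proof -
  have "color_corner M i c \<in> corners (color_submap M i)
      \<and> corner_vertex M (color_corner M i c) = corner_vertex M c"
  proof (cases c)
    case (After a)
    then have a: "a \<in> arcs (mgraph M)" using assms by (auto simp: corners_def)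
    let ?A = "{b \<in> arcs (mgraph M). tail (mgraph M) b = tail (mgraph M) a \<and> ecol M b = i}"
    let ?k = "LEAST k. (inv (esucc M) ^^ k) a \<in> ?A"
    show ?thesis
    proof (cases "?A = {}")
      case True
      then show ?thesis using After a by (auto simp: corners_def color_submap_simps out_arcs_def)
    next
      case False
      then obtain b where b: "b \<in> ?A" by blast
      then have "b \<in> orbit (inv (esucc M)) a"
        using a orbit_esucc[of a] by (simp add: orbit_inv_eq[OF permutation_esucc])
      then obtain n where "(inv (esucc M) ^^ n) a = b" by (auto simp: orbit_altdef)
      then have "(inv (esucc M) ^^ n) a \<in> ?A" using b by simp
      then have "(inv (esucc M) ^^ ?k) a \<in> ?A" by (rule LeastI)
      moreover have "color_corner M i c = After ((inv (esucc M) ^^ ?k) a)"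
        using False by (simp only: After color_corner.simps Let_def if_False)
      ultimately show ?thesis using After by (simp add: corners_def color_submap_simps)
    qed
  next
    case (Lone v)
    then show ?thesis using assms by (auto simp: corners_def color_submap_simps out_arcs_def)
  qed
  then show "color_corner M i c \<in> corners (color_submap M i)"
    "corner_vertex M (color_corner M i c) = corner_vertex M c" by auto
qed

lemma corner_vertex_surj: "corner_vertex M ` corners M = verts (mgraph M)"
proof
  show "corner_vertex M ` corners M \<subseteq> verts (mgraph M)" using corner_vertex_in_verts by blast
  show "verts (mgraph M) \<subseteq> corner_vertex M ` corners M"
  proof
    fix v assume v: "v \<in> verts (mgraph M)"
    show "v \<in> corner_vertex M ` corners M"
    proof (cases "out_arcs (mgraph M) v = {}")
      case True
      then show ?thesis using v by (intro image_eqI[of _ _ "Lone v"]) (auto simp: corners_def)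
    next
      case False
      then obtain a where "a \<in> out_arcs (mgraph M) v" by blast
      then show ?thesis by (intro image_eqI[of _ _ "After a"]) (auto simp: corners_def)
    qed
  qed
qed

lemma finite_corners: "finite (corners M)"
  by (simp add: corners_def)

lemma ex_orientation: "\<exists>R. arcs (mgraph M) = R \<union> erev M ` R \<and> R \<inter> erev M ` R = {}"
proof -
  \<comment> \<open>The choice depends only on the set \<open>{a, erev M a}\<close>, so both halves
    of an edge select the same half.\<close>
  define s where "s a = (SOME b. b \<in> {a, erev M a})" for a
  have s: "s a \<in> {a, erev M a}" for a
    unfolding s_def by (rule someI[of _ a]) simp
  have s_rev: "s (erev M a) = s a" for a
    by (simp add: s_def insert_commute)
  have s_in: "s a \<in> arcs (mgraph M)" if "a \<in> arcs (mgraph M)" for a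
    using s[of a] that by auto
  have "a \<in> s ` arcs (mgraph M) \<union> erev M ` s ` arcs (mgraph M)" if a: "a \<in> arcs (mgraph M)" for a
  proof -
    have "a = s a \<or> a = erev M (s a)" using s[of a] by auto
    then show ?thesis using a by blast
  qed
  then have "arcs (mgraph M) = s ` arcs (mgraph M) \<union> erev M ` s ` arcs (mgraph M)"
    using s_in by auto
  moreover have False if "a \<in> arcs (mgraph M)" "b \<in> arcs (mgraph M)" "s a = erev M (s b)" for a b
  proof -
    have s_s: "s (s c) = s c" for c using s[of c] s_rev[of c] by auto
    have "s a = s b" using s_s[of a] s_s[of b] s_rev[of "s b"] that(3) by simp
    then show False using that(2,3) arev_neq[OF s_in[OF that(2)]] by simp
  qed
  then have "s ` arcs (mgraph M) \<inter> erev M ` s ` arcs (mgraph M) = {}" by blast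
  ultimately show ?thesis by blast
qed

end

text \<open>An orientation \<open>R\<close> has one half-edge of every edge, and stands for the set of edges.\<close>

locale oriented_map = colored_map +
  fixes R :: "'b set"
  assumes arcs_orient: "arcs (mgraph M) = R \<union> erev M ` R"
    and orient_disjoint: "R \<inter> erev M ` R = {}"
begin

lemma orient_subset: "R \<subseteq> arcs (mgraph M)"
  using arcs_orient by blast

lemma finite_orient: "finite R"
  using orient_subset finite_arcs by (rule finite_subset)

lemma orient_ends: "e \<in> R \<Longrightarrow> tail (mgraph M) e \<in> verts (mgraph M) \<and> head (mgraph M) e \<in> verts (mgraph M)"
  using orient_subset by auto

lemma card_map_edges: "card (map_edges M) = card R"
proof -
  have "map_edges M = (\<lambda>a. {a, erev M a}) ` R"
    unfolding map_edges_def arcs_orient image_Un image_image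
    by (simp add: insert_commute)
  moreover have "inj_on (\<lambda>a. {a, erev M a}) R"
    using orient_disjoint by (auto simp: inj_on_def doubleton_eq_iff)
  ultimately show ?thesis by (simp add: card_image)
qed

text \<open>Through this, every result on oriented maps applies to each color separately.\<close>

lemma oriented_map_color_submap:
  "oriented_map D (color_submap M i) {a \<in> R. ecol M a = i}"
proof -
  interpret N: colored_map D "color_submap M i" by (rule colored_map_color_submap)
  show ?thesis
  proof
    let ?S = "{a \<in> R. ecol M a = i}"
    have col: "ecol M (erev M a) = ecol M a" if "a \<in> R" for a
      using that orient_subset ecol_erev by blast
    have rev: "erev (color_submap M i) ` ?S = erev M ` ?S"
      using orient_subset by (intro image_cong) (auto simp: color_submap_simps)
    show "?S \<inter> erev (color_submap M i) ` ?S = {}" unfolding rev using orient_disjoint by blast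
    show "arcs (mgraph (color_submap M i)) = ?S \<union> erev (color_submap M i) ` ?S"
      unfolding rev color_submap_simps arcs_orient using col by auto
  qed
qed

text \<open>Connectivity ignores directions, so one half of each edge generates it; components and
  ranks can thus be computed from \<open>R\<close>.\<close>

lemma econn_arcs:
  assumes "A \<subseteq> R"
  shows "econn (tail (mgraph M)) (head (mgraph M)) (A \<union> erev M ` A) = econn (tail (mgraph M)) (head (mgraph M)) A"
proof
  show "econn (tail (mgraph M)) (head (mgraph M)) (A \<union> erev M ` A)
      \<subseteq> econn (tail (mgraph M)) (head (mgraph M)) A"
  proof (rule econn_subset_econn)
    fix e assume "e \<in> A \<union> erev M ` A"
    then show "(tail (mgraph M) e, head (mgraph M) e) \<in> econn (tail (mgraph M)) (head (mgraph M)) A"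
    proof
      assume "e \<in> erev M ` A"
      then obtain d where d: "d \<in> A" "e = erev M d" by blast
      moreover have "d \<in> arcs (mgraph M)" using d assms orient_subset by blast
      ultimately show ?thesis using econn_sym[OF econn_edge[OF d(1)]] by simp
    qed (rule econn_edge)
  qed
qed (rule econn_mono, blast)

lemma components_orient:
  "components (mgraph M) = conn_classes (verts (mgraph M)) (tail (mgraph M)) (head (mgraph M)) R"
  using econn_arcs[of R] arcs_orient
  by (simp add: components_eq_conn_classes conn_classes_def)

lemma bidirected_forest_orient:
  "bidirected_forest (mgraph M) (erev M)
    \<longleftrightarrow> cyclomatic (verts (mgraph M)) (tail (mgraph M)) (head (mgraph M)) R = 0"
  by (rule bidirected_forest_iff_cyclomatic[OF finite_verts finite_arcs arcs_orient orient_disjoint])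
    simp_all

text \<open>
  Only the edges in \<open>A\<close> are followed; a half-edge of any other edge is merely passed by.
  This lets the edges be added one at a time without changing the set of half-edges.
\<close>

fun partial_face :: "'b set \<Rightarrow> ('a, 'b) corner \<Rightarrow> ('a, 'b) corner" where
  "partial_face A (After a) =
     After (if esucc M a \<in> A \<union> erev M ` A then erev M (esucc M a) else esucc M a)"
| "partial_face A (Lone v) = Lone v"

text \<open>On half-edges outside the map \<open>erev\<close> is the identity, so the membership
  test in \<open>partial_face\<close> changes nothing there.\<close>

lemma partial_face_orient: "partial_face R = face_succ M"
proof
  fix c :: "('a, 'b) corner"
  show "partial_face R c = face_succ M c"
  proof (cases c)
    case (After a)
    then show ?thesis
      using arev_eq[of "esucc M a"] by (simp add: arcs_orient[symmetric] del: Un_iff)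
  qed simp
qed

lemma partial_face_empty_permutes: "partial_face {} permutes corners M"
  unfolding permutes_def
proof (intro conjI allI impI)
  fix x assume "x \<notin> corners M"
  then show "partial_face {} x = x"
    using permutes_not_in[OF esucc_permutes] by (cases x) (auto simp: corners_def)
next
  fix y show "\<exists>!x. partial_face {} x = y"
  proof (cases y)
    case (After b)
    show ?thesis
    proof
      show "partial_face {} (After (inv (esucc M) b)) = y"
        using After permutes_inverses[OF esucc_permutes] by simp
      show "x = After (inv (esucc M) b)" if "partial_face {} x = y" for x
        using that After permutes_inverses[OF esucc_permutes] by (cases x) auto
    qed
  next
    case (Lone v)
    show ?thesis
    proof
      show "partial_face {} (Lone v) = y" using Lone by simp
      show "x = Lone v" if "partial_face {} x = y" for x
        using that Lone by (cases x) auto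
    qed
  qed
qed

text \<open>With no edge followed, the walk merely turns around a vertex, so each vertex accounts
  for one orbit. This starts the induction on the edges.\<close>

lemma card_orbits_partial_face_empty:
  "card (orbit (partial_face {}) ` corners M) \<le> card (verts (mgraph M))"
proof -
  let ?o = "\<lambda>v. if out_arcs (mgraph M) v = {} then {Lone v} else After ` out_arcs (mgraph M) v"
  have "orbit (partial_face {}) c = ?o (corner_vertex M c)" if "c \<in> corners M" for c
  proof (cases c)
    case (After a)
    then have a: "a \<in> arcs (mgraph M)" using that by (auto simp: corners_def)
    have "After ` orbit (esucc M) a = orbit (partial_face {}) (After a)"
      by (rule orbit_inverse) (simp_all add: permutation_self_in_orbit[OF permutation_esucc])
    then show ?thesis using After a orbit_esucc[OF a] by auto
  next
    case (Lone v)
    then have "orbit (partial_face {}) c = {c}" by (simp add: orbit_eq_singleton_iff)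
    then show ?thesis using that Lone by (auto simp: corners_def)
  qed
  then have "orbit (partial_face {}) ` corners M \<subseteq> ?o ` verts (mgraph M)"
    using corner_vertex_in_verts by auto
  then have "card (orbit (partial_face {}) ` corners M) \<le> card (?o ` verts (mgraph M))"
    by (intro card_mono) auto
  also have "\<dots> \<le> card (verts (mgraph M))" by (rule card_image_le) simp
  finally show ?thesis .
qed

text \<open>Each step stays at a vertex or crosses an edge of \<open>A\<close>. If \<open>A\<close>
  does not connect the ends of a new edge, its two halves therefore lie on different orbits.\<close>

lemma partial_face_connected:
  assumes "A \<subseteq> R" "d \<in> orbit (partial_face A) c"
  shows "(corner_vertex M c, corner_vertex M d) \<in> econn (tail (mgraph M)) (head (mgraph M)) A"
proof -
  have face_step: "(corner_vertex M c, corner_vertex M (partial_face A c))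
      \<in> econn (tail (mgraph M)) (head (mgraph M)) A" for c
  proof (cases c)
    case (After a)
    let ?b = "esucc M a"
    show ?thesis
    proof (cases "?b \<in> A \<union> erev M ` A")
      case True
      then have b: "?b \<in> arcs (mgraph M)" using assms(1) arcs_orient by auto
      have "(tail (mgraph M) ?b, head (mgraph M) ?b)
          \<in> econn (tail (mgraph M)) (head (mgraph M)) (A \<union> erev M ` A)"
        using True by (rule econn_edge)
      then show ?thesis using After True b econn_arcs[OF assms(1)] by simp
    next
      case False
      then show ?thesis
      proof (cases "a \<in> arcs (mgraph M)")
        case True
        then show ?thesis using False After by simp
      next
        case outside: False
        then show ?thesis using False After permutes_not_in[OF esucc_permutes outside] by simp
      qed
    qed
  qed simp
  from assms(2) show ?thesis
  proof induction
    case (step d)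
    show ?case using step.IH face_step by (rule econn_trans)
  qed (rule face_step)
qed

text \<open>Neither half of \<open>e\<close> is followed under \<open>A\<close>, so a step may end
  just after either of them; following \<open>e\<close> as well exchanges these two results.\<close>

lemma partial_face_insert:
  assumes "insert e A \<subseteq> R" "e \<notin> A"
  shows "partial_face (insert e A) = transpose (After e) (After (erev M e)) \<circ> partial_face A"
proof
  fix c
  have e: "e \<notin> A \<union> erev M ` A" "erev M e \<notin> A \<union> erev M ` A"
    using assms orient_disjoint by (auto simp: arev_eq_iff)
  show "partial_face (insert e A) c = (transpose (After e) (After (erev M e)) \<circ> partial_face A) c"
  proof (cases c)
    case (After a)
    let ?b = "esucc M a"
    consider "?b = e" | "?b = erev M e" | "?b \<noteq> e" "?b \<noteq> erev M e" by blast
    then show ?thesis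
    proof cases
      case 3
      moreover from 3 have "erev M ?b \<noteq> e" "erev M ?b \<noteq> erev M e" by (auto simp: arev_eq_iff)
      ultimately show ?thesis using After by (simp add: transpose_def)
    qed (use After e in simp_all)
  qed (simp add: transpose_def)
qed

text \<open>
  Adding an edge between two components of the graph merges two faces, and adding an edge
  inside a component changes the number of faces by at most one.
\<close>

lemma partial_face_bound:
  assumes "A \<subseteq> R"
  shows "partial_face A permutes corners M
    \<and> int (card (orbit (partial_face A) ` corners M))
      \<le> cyclomatic (verts (mgraph M)) (tail (mgraph M)) (head (mgraph M)) A
        + int (card (conn_classes (verts (mgraph M)) (tail (mgraph M)) (head (mgraph M)) A))"
proof -
  have "finite A" using assms finite_orient by (rule finite_subset)
  then show ?thesis
    using assms
  proof (induction A rule: finite_induct)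
    case empty
    then show ?case
      using partial_face_empty_permutes card_orbits_partial_face_empty
      by (simp add: cyclomatic_empty conn_classes_empty card_image)
  next
    case (insert e A)
    let ?V = "verts (mgraph M)" and ?t = "tail (mgraph M)" and ?h = "head (mgraph M)"
    let ?a = "After e :: ('a, 'b) corner" and ?b = "After (erev M e) :: ('a, 'b) corner"
    have IH: "partial_face A permutes corners M"
      "int (card (orbit (partial_face A) ` corners M))
        \<le> cyclomatic ?V ?t ?h A + int (card (conn_classes ?V ?t ?h A))"
      using insert by auto
    have eq: "partial_face (insert e A) = transpose ?a ?b \<circ> partial_face A"
      using insert by (intro partial_face_insert) auto
    have e: "e \<in> arcs (mgraph M)" using insert orient_subset by auto
    then have ab: "?a \<in> corners M" "?b \<in> corners M" by (auto simp: corners_def)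
    have perm: "partial_face (insert e A) permutes corners M"
      unfolding eq using IH(1) ab by (intro permutes_compose permutes_swap_id)
    have cyc: "cyclomatic ?V ?t ?h (insert e A)
        = cyclomatic ?V ?t ?h A + (if (?t e, ?h e) \<in> econn ?t ?h A then 1 else 0)"
      using insert e by (intro cyclomatic_insert) auto
    show ?case
    proof (cases "(?t e, ?h e) \<in> econn ?t ?h A")
      case True
      then have "conn_classes ?V ?t ?h (insert e A) = conn_classes ?V ?t ?h A"
        by (simp add: conn_classes_def econn_insert_connected)
      moreover have "card (orbit (partial_face (insert e A)) ` corners M)
          \<le> Suc (card (orbit (partial_face A) ` corners M))"
        unfolding eq by (rule card_orbits_transpose(1)[OF IH(1) finite_corners ab])
      ultimately show ?thesis using perm IH(2) cyc True by simp
    next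
      case False
      have "card (conn_classes ?V ?t ?h A) = Suc (card (conn_classes ?V ?t ?h (insert e A)))"
        using e False by (intro card_conn_classes_insert) auto
      moreover have "?b \<notin> orbit (partial_face A) ?a"
        using partial_face_connected[of A ?b ?a] insert e False by auto
      then have "Suc (card (orbit (partial_face (insert e A)) ` corners M))
          \<le> card (orbit (partial_face A) ` corners M)"
        unfolding eq by (rule card_orbits_transpose(2)[OF IH(1) finite_corners ab])
      ultimately show ?thesis using perm IH(2) cyc False by simp
    qed
  qed
qed

lemma face_succ_permutes: "face_succ M permutes corners M"
  using partial_face_bound[of R] by (simp add: partial_face_orient)

lemma permutation_face_succ: "permutation (face_succ M)"
  unfolding permutation_permutes using face_succ_permutes finite_corners by blast

lemma card_faces_le:
  "int (card (faces M))
    \<le> cyclomatic (verts (mgraph M)) (tail (mgraph M)) (head (mgraph M)) R + int (card (components (mgraph M)))"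
  using partial_face_bound[of R] by (simp add: partial_face_orient faces_def components_orient)

section \<open>Faces and the components in which they run\<close>

definition face_component :: "('a, 'b) corner set \<Rightarrow> 'a set" where
  "face_component f = econn (tail (mgraph M)) (head (mgraph M)) R `` (corner_vertex M ` f)"

lemma face_component_orbit:
  assumes "d \<in> orbit (face_succ M) c"
  shows "face_component (orbit (face_succ M) c)
    = econn (tail (mgraph M)) (head (mgraph M)) R `` {corner_vertex M d}"
proof -
  have conn: "(corner_vertex M c, corner_vertex M d') \<in> econn (tail (mgraph M)) (head (mgraph M)) R"
    if "d' \<in> orbit (face_succ M) c" for d'
    using partial_face_connected[of R d' c] that by (simp add: partial_face_orient)
  have "econn (tail (mgraph M)) (head (mgraph M)) R `` {corner_vertex M d'}
      = econn (tail (mgraph M)) (head (mgraph M)) R `` {corner_vertex M d}"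
    if "d' \<in> orbit (face_succ M) c" for d'
    unfolding econn_class_eq_iff using conn[OF that] conn[OF assms] by (meson econn_sym econn_trans)
  then show ?thesis using assms unfolding face_component_def by blast
qed

text \<open>Every vertex carries a corner, even an isolated one, so every component contains a
  face.\<close>

lemma face_component_faces: "face_component ` faces M = components (mgraph M)"
proof -
  have "face_component (orbit (face_succ M) c)
      = econn (tail (mgraph M)) (head (mgraph M)) R `` {corner_vertex M c}" for c
    by (rule face_component_orbit) (rule permutation_self_in_orbit[OF permutation_face_succ])
  then have "face_component ` faces M
      = (\<lambda>v. econn (tail (mgraph M)) (head (mgraph M)) R `` {v}) ` corner_vertex M ` corners M"
    by (simp add: faces_def image_image)
  then show ?thesis by (simp add: corner_vertex_surj components_orient conn_classes_def)
qed

lemma face_component_faces_meeting: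
  assumes "T \<subseteq> corners M"
  shows "face_component ` {f \<in> faces M. f \<inter> T \<noteq> {}}
    = {S \<in> components (mgraph M). S \<inter> corner_vertex M ` T \<noteq> {}}" (is "?F = ?S")
proof
  show "?F \<subseteq> ?S"
  proof
    fix S assume "S \<in> ?F"
    then obtain f c where f: "f \<in> faces M" "S = face_component f" "c \<in> f" "c \<in> T" by blast
    then have "S = econn (tail (mgraph M)) (head (mgraph M)) R `` {corner_vertex M c}"
      using face_component_orbit[of c] by (auto simp: faces_def)
    then have "corner_vertex M c \<in> S" by simp
    then show "S \<in> ?S" using f face_component_faces by blast
  qed
  show "?S \<subseteq> ?F"
  proof
    fix S assume S: "S \<in> ?S"
    then obtain c where c: "c \<in> T" "corner_vertex M c \<in> S" by blast
    have self: "c \<in> orbit (face_succ M) c"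
      by (rule permutation_self_in_orbit[OF permutation_face_succ])
    have "S = econn (tail (mgraph M)) (head (mgraph M)) R `` {corner_vertex M c}"
      using S c by (intro conn_classes_eq_class) (auto simp: components_orient)
    then have "S = face_component (orbit (face_succ M) c)"
      using face_component_orbit[OF self] by simp
    moreover have "orbit (face_succ M) c \<in> faces M" using c assms by (auto simp: faces_def)
    ultimately show "S \<in> ?F" using self c by blast
  qed
qed

lemma finite_faces: "finite (faces M)"
  by (simp add: faces_def finite_corners)

lemma card_components_le_card_faces: "card (components (mgraph M)) \<le> card (faces M)"
  using card_image_le[OF finite_faces, of face_component] by (simp add: face_component_faces)

lemma card_marked_components_le:
  assumes "T \<subseteq> corners M"
  shows "card {S \<in> components (mgraph M). S \<inter> corner_vertex M ` T \<noteq> {}}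
    \<le> card {f \<in> faces M. f \<inter> T \<noteq> {}}"
  unfolding face_component_faces_meeting[OF assms, symmetric]
  by (rule card_image_le) (simp add: finite_faces)

text \<open>Each component has at least one face, and Euler's inequality with rank zero allows no
  more.\<close>

lemma card_faces_forest:
  assumes "cyclomatic (verts (mgraph M)) (tail (mgraph M)) (head (mgraph M)) R = 0"
  shows "card (faces M) = card (components (mgraph M))"
  using card_faces_le card_components_le_card_faces assms by simp

text \<open>Rank zero makes \<open>face_component\<close> a surjection between finite sets of equal
  size, hence injective, and it stays injective on the faces that meet \<open>T\<close>.\<close>

lemma card_marked_components_forest:
  assumes "cyclomatic (verts (mgraph M)) (tail (mgraph M)) (head (mgraph M)) R = 0"
    and "T \<subseteq> corners M"
  shows "card {S \<in> components (mgraph M). S \<inter> corner_vertex M ` T \<noteq> {}}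
    = card {f \<in> faces M. f \<inter> T \<noteq> {}}"
proof -
  have "inj_on face_component (faces M)"
    using card_faces_forest[OF assms(1)] finite_faces
    by (intro eq_card_imp_inj_on) (simp_all add: face_component_faces)
  then have "inj_on face_component {f \<in> faces M. f \<inter> T \<noteq> {}}"
    by (rule inj_on_subset) blast
  then show ?thesis
    unfolding face_component_faces_meeting[OF assms(2), symmetric] by (rule card_image)
qed

end

section \<open>Maps with marked corners\<close>

text \<open>The edges trace the first-return map on \<open>T\<close> through the labelling
  \<open>g\<close>, so their components come from the orbits. This describes one color of the
  contracted boundary graph, whose edges follow faces from mark to mark.\<close>

lemma econn_first_return:
  assumes f: "permutation f" and inj: "inj_on g T" and x: "x \<in> T"
    and s: "s ` A = T"
    and th: "\<And>e. e \<in> A \<Longrightarrow> t e = g (s e)" "\<And>e. e \<in> A \<Longrightarrow> h e = g (first_return f T (s e))"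
  shows "econn t h A `` {g x} = g ` (orbit f x \<inter> T)"
proof
  show "econn t h A `` {g x} \<subseteq> g ` (orbit f x \<inter> T)"
  proof
    fix v assume "v \<in> econn t h A `` {g x}"
    then have "(g x, v) \<in> econn t h A" by simp
    then show "v \<in> g ` (orbit f x \<inter> T)"
    proof (induction rule: econn_induct)
      case base
      then show ?case using x permutation_self_in_orbit[OF f] by blast
    next
      case (step e)
      let ?y = "s e"
      have y: "?y \<in> T" using s step by blast
      let ?z = "first_return f T ?y"
      have z: "?z \<in> T" by (rule first_return_in[OF f y])
      \<comment> \<open>Injectivity of \<open>g\<close> turns membership of a label into equality of
        orbits, which a first return preserves.\<close>
      have iff: "g w \<in> g ` (orbit f x \<inter> T) \<longleftrightarrow> orbit f x = orbit f w" if "w \<in> T" for w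
        using inj_on_image_mem_iff[OF inj that, of "orbit f x \<inter> T"] that orbit_eq_iff[OF f]
        by simp
      have "?z \<in> orbit f ?y"
        using first_returnE[OF f y] orbit_altdef by (metis (mono_tags, lifting) mem_Collect_eq)
      then have "orbit f ?y = orbit f ?z" using orbit_eq_iff[OF f] by simp
      then show ?case using iff[OF y] iff[OF z] th[OF step] by simp
    qed
  qed
  let ?r = "\<lambda>x. if x \<in> T then first_return f T x else x"
  have r: "orbit ?r x = orbit f x \<inter> T" by (rule orbit_first_return[OF f x]) simp
  have edge: "(g y, g (?r y)) \<in> econn t h A" if y: "y \<in> T" for y
  proof -
    obtain e where e: "e \<in> A" "s e = y" using s y by blast
    show ?thesis using econn_edge[OF e(1), of t h] th[OF e(1)] e(2) y by simp
  qed
  show "g ` (orbit f x \<inter> T) \<subseteq> econn t h A `` {g x}"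
  proof
    fix v assume "v \<in> g ` (orbit f x \<inter> T)"
    then obtain y where y: "y \<in> orbit ?r x" "v = g y" using r by blast
    from y(1) have "(g x, g y) \<in> econn t h A"
    proof induction
      case base
      then show ?case by (rule edge[OF x])
    next
      case (step y)
      then have "y \<in> T" using r by blast
      then show ?case using econn_trans[OF step.IH edge] by blast
    qed
    then show "v \<in> econn t h A `` {g x}" using y(2) by simp
  qed
qed

text \<open>Different orbits through \<open>T\<close> have different traces on it, and injectivity
  of \<open>g\<close> keeps the images apart, so components and orbits correspond one to
  one.\<close>

lemma card_conn_classes_first_return:
  assumes f: "permutation f" and inj: "inj_on g T"
    and s: "s ` A = T"
    and th: "\<And>e. e \<in> A \<Longrightarrow> t e = g (s e)" "\<And>e. e \<in> A \<Longrightarrow> h e = g (first_return f T (s e))"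
  shows "card (conn_classes (g ` T) t h A) = card (orbit f ` T)"
proof -
  have "econn t h A `` {g x} = g ` (orbit f x \<inter> T)" if "x \<in> T" for x
    by (rule econn_first_return[OF f inj that s th])
  then have "conn_classes (g ` T) t h A = (\<lambda>S. g ` (S \<inter> T)) ` orbit f ` T"
    unfolding conn_classes_def image_image by (rule image_cong[OF refl])
  moreover have "inj_on (\<lambda>S. g ` (S \<inter> T)) (orbit f ` T)"
  proof (rule inj_onI)
    fix S S' assume S: "S \<in> orbit f ` T" "S' \<in> orbit f ` T" "g ` (S \<inter> T) = g ` (S' \<inter> T)"
    then obtain x y where xy: "x \<in> T" "S = orbit f x" "S' = orbit f y" by blast
    have "S \<inter> T = S' \<inter> T"
      using S(3) inj inj_on_image_eq_iff[of g T "S \<inter> T" "S' \<inter> T"] by simp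
    then have "x \<in> orbit f y" using xy permutation_self_in_orbit[OF f, of x] by blast
    then show "S = S'" using xy orbit_eq_iff[OF f] by metis
  qed
  ultimately show ?thesis by (simp add: card_image)
qed

text \<open>The overlap of \<open>A i\<close> with the union of the other sets is lost in the union
  bound, so equality forces it to be empty.\<close>

lemma card_UN_eq_sum_imp_disjoint:
  assumes "finite I" "\<And>i. i \<in> I \<Longrightarrow> finite (A i)" "card (\<Union>i\<in>I. A i) = (\<Sum>i\<in>I. card (A i))"
    and "i \<in> I" "j \<in> I" "i \<noteq> j"
  shows "A i \<inter> A j = {}"
proof -
  have fin: "finite (\<Union>k\<in>I - {i}. A k)" using assms(1,2) by auto
  have "(\<Union>k\<in>I. A k) = A i \<union> (\<Union>k\<in>I - {i}. A k)" using assms(4) by blast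
  then have "card (\<Union>k\<in>I. A k) + card (A i \<inter> (\<Union>k\<in>I - {i}. A k))
      = card (A i) + card (\<Union>k\<in>I - {i}. A k)"
    using card_Un_Int[OF assms(2)[OF assms(4)] fin] by simp
  also have "\<dots> \<le> card (A i) + (\<Sum>k\<in>I - {i}. card (A k))"
    using card_UN_le[of "I - {i}" A] assms(1) by simp
  also have "\<dots> = (\<Sum>k\<in>I. card (A k))" using assms(1,4) by (simp add: sum.remove)
  finally have "card (A i \<inter> (\<Union>k\<in>I - {i}. A k)) = 0" using assms(3) by simp
  then have "A i \<inter> (\<Union>k\<in>I - {i}. A k) = {}" using fin by simp
  then show ?thesis using assms(5,6) by blast
qed

locale marked_map = oriented_map +
  fixes C :: "('a, 'b) corner set"
  assumes marked: "marked_corners M C"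
begin

abbreviation "V \<equiv> verts (mgraph M)"
abbreviation "conn \<equiv> econn (tail (mgraph M)) (head (mgraph M))"
abbreviation "classes \<equiv> conn_classes V (tail (mgraph M)) (head (mgraph M))"
abbreviation "cyc \<equiv> cyclomatic V (tail (mgraph M)) (head (mgraph M))"
abbreviation "MV \<equiv> marked_verts M C"
abbreviation "edges i \<equiv> {a \<in> R. ecol M a = i}"
abbreviation "color_comps i \<equiv> components (mgraph (color_submap M i))"
abbreviation "X i \<equiv> verts (external_part M C i)"
abbreviation "external_faces i \<equiv> {f \<in> faces (color_submap M i). f \<inter> color_corner M i ` C \<noteq> {}}"

lemma C_subset: "C \<subseteq> corners M" and inj_corner_vertex: "inj_on (corner_vertex M) C"
  using marked by (auto simp: marked_corners_def)

lemma marked_verts_subset: "MV \<subseteq> V"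
  using C_subset corner_vertex_in_verts by (auto simp: marked_verts_def)

lemma card_marked_verts: "card MV = card C"
  by (simp add: marked_verts_def card_image inj_corner_vertex)

lemma color_corner_C:
  shows "color_corner M i ` C \<subseteq> corners (color_submap M i)"
    and "corner_vertex M ` color_corner M i ` C = MV"
    and "inj_on (corner_vertex M) (color_corner M i ` C)"
proof -
  have c: "c \<in> C \<Longrightarrow> c \<in> corners M" for c using C_subset by blast
  show "color_corner M i ` C \<subseteq> corners (color_submap M i)" using color_corner(1) c by blast
  show "corner_vertex M ` color_corner M i ` C = MV"
    using color_corner(2) c by (force simp: marked_verts_def image_image)
  show "inj_on (corner_vertex M) (color_corner M i ` C)"
    using inj_corner_vertex color_corner(2) c by (auto simp: inj_on_def)
qed

lemma permutation_color_face: "permutation (face_succ (color_submap M i))"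
  by (rule oriented_map.permutation_face_succ[OF oriented_map_color_submap])

lemma card_faces_split:
  "card (faces (color_submap M i)) = card (internal_faces M C i) + card (external_faces i)"
proof -
  have "finite (faces (color_submap M i))"
    by (rule oriented_map.finite_faces[OF oriented_map_color_submap])
  then have fin: "finite (internal_faces M C i)" "finite (external_faces i)"
    by (simp_all add: internal_faces_def)
  have disj: "internal_faces M C i \<inter> external_faces i = {}"
    by (auto simp: internal_faces_def)
  have "faces (color_submap M i) = internal_faces M C i \<union> external_faces i"
    by (auto simp: internal_faces_def)
  then have "card (faces (color_submap M i)) = card (internal_faces M C i \<union> external_faces i)"
    by (rule arg_cong)
  also have "\<dots> = card (internal_faces M C i) + card (external_faces i)"
    by (rule card_Un_disjoint[OF fin disj])
  finally show ?thesis .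
qed

section \<open>The contracted boundary graph and its ranks\<close>

definition vertex_pair :: "'a \<Rightarrow> ('a \<times> shade) set" where
  "vertex_pair v = {(v, Black), (v, White)}"

definition next_marked :: "nat \<Rightarrow> ('a, 'b) corner \<Rightarrow> ('a, 'b) corner" where
  "next_marked i c
    = first_return (face_succ (color_submap M i)) (color_corner M i ` C) (color_corner M i c)"

lemma vertex_pair_inj: "inj_on vertex_pair A"
  by (auto simp: inj_on_def vertex_pair_def doubleton_eq_iff)

lemma next_marked_in: "c \<in> C \<Longrightarrow> corner_vertex M (next_marked i c) \<in> MV"
  using first_return_in[OF permutation_color_face, of "color_corner M i c" "color_corner M i ` C"]
    color_corner_C(2)[of i]
  by (auto simp: next_marked_def)

text \<open>Each boundary vertex lies in exactly one pair, which resolves the description in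
  \<open>contract\<close>.\<close>

lemma the_vertex_pair:
  assumes "v \<in> MV"
  shows "(THE p. p \<in> pairing M C \<and> (v, x) \<in> p) = vertex_pair v"
proof (rule the_equality)
  show "vertex_pair v \<in> pairing M C \<and> (v, x) \<in> vertex_pair v"
    using assms by (cases x) (auto simp: pairing_def vertex_pair_def)
qed (auto simp: pairing_def vertex_pair_def)

abbreviation "boundary \<equiv> boundary_graph D M C"
abbreviation "contracted \<equiv> contract boundary (pairing M C)"

lemma boundary_simps:
  "verts boundary = MV \<times> {Black, White}"
  "arcs boundary = {1..D} \<times> C"
  "tail boundary (i, c) = (corner_vertex M c, Black)"
  "head boundary (i, c) = (corner_vertex M (next_marked i c), White)"
  by (simp_all add: boundary_graph_def next_marked_def)

lemma wf_boundary: "wf_digraph boundary"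
  by unfold_locales (auto simp: boundary_simps next_marked_in, auto simp: marked_verts_def)

lemma contracted_simps:
  "verts contracted = vertex_pair ` MV"
  "arcs contracted = {1..D} \<times> C"
  "c \<in> C \<Longrightarrow> tail contracted (i, c) = vertex_pair (corner_vertex M c)"
  "c \<in> C \<Longrightarrow> head contracted (i, c) = vertex_pair (corner_vertex M (next_marked i c))"
proof -
  show "verts contracted = vertex_pair ` MV"
    by (simp add: contract_def pairing_def vertex_pair_def[abs_def])
  show "arcs contracted = {1..D} \<times> C" by (simp add: contract_def boundary_simps)
  assume c: "c \<in> C"
  then have "corner_vertex M c \<in> MV" by (auto simp: marked_verts_def)
  then show "tail contracted (i, c) = vertex_pair (corner_vertex M c)"
    by (simp add: contract_def boundary_simps the_vertex_pair)
  show "head contracted (i, c) = vertex_pair (corner_vertex M (next_marked i c))"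
    using next_marked_in[OF c] by (simp add: contract_def boundary_simps the_vertex_pair)
qed

lemma wf_contracted: "wf_digraph contracted"
  by unfold_locales
    (auto simp: contracted_simps(1,2) contracted_simps(3,4) next_marked_in, auto simp: marked_verts_def)

lemma card_verts_contracted: "card (verts contracted) = card C"
  by (simp add: contracted_simps card_image vertex_pair_inj card_marked_verts)

text \<open>Contraction keeps the boundary graph connected, so there is one component, with
  \<open>card C\<close> vertices and \<open>D\<close> edges leaving each.\<close>

lemma circuit_rank_contracted:
  assumes "connected boundary"
  shows "circuit_rank contracted = int D * int (card C) - int (card C) + 1"
proof -
  let ?Q = "econn (tail contracted) (head contracted) (arcs contracted)"
  have conn: "(x, y) \<in> econn (tail boundary) (head boundary) (arcs boundary)"
    if "x \<in> verts boundary" "y \<in> verts boundary" for x y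
    using assms that by (simp add: wf_digraph.connected_iff_econn[OF wf_boundary])
  have "(vertex_pair u, vertex_pair v) \<in> ?Q" if "u \<in> MV" "v \<in> MV" for u v
  proof -
    have "((u, Black), (v, Black)) \<in> econn (tail boundary) (head boundary) (arcs boundary)"
      using that by (intro conn) (auto simp: boundary_simps)
    \<comment> \<open>The target is written with \<open>fst\<close> so that the induction can run
      over boundary vertices of either shade.\<close>
    then have "(vertex_pair u, vertex_pair (fst (v, Black))) \<in> ?Q"
    proof (induction rule: econn_induct[where P = "\<lambda>y. (vertex_pair u, vertex_pair (fst y)) \<in> ?Q"])
      case base
      then show ?case by simp
    next
      case (step e)
      obtain i c where e: "e = (i, c)" "c \<in> C" using step by (cases e) (auto simp: boundary_simps)
      have "e \<in> arcs contracted" using step by (simp add: boundary_simps contracted_simps)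
      then have "(tail contracted e, head contracted e) \<in> ?Q" by (rule econn_edge)
      then show ?case
        using e by (simp add: boundary_simps contracted_simps) (meson econn_sym econn_trans)
    qed
    then show ?thesis by simp
  qed
  then have same: "?Q `` {p} = ?Q `` {p'}" if "p \<in> verts contracted" "p' \<in> verts contracted" for p p'
    using that unfolding econn_class_eq_iff by (auto simp: contracted_simps)
  have "verts boundary \<noteq> {}" using assms by (simp add: wf_digraph.connected_iff_econn[OF wf_boundary])
  then obtain p where p: "p \<in> verts contracted" by (auto simp: boundary_simps contracted_simps)
  have "components contracted = {?Q `` {p}}"
    unfolding wf_digraph.components_eq_conn_classes[OF wf_contracted] conn_classes_def
    using same[OF _ p] p by blast
  then show ?thesis
    unfolding circuit_rank_def card_verts_contracted
    by (simp add: contracted_simps card_cartesian_product)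
qed

text \<open>One color has as many edges as there are vertices, so its rank is its number of
  components, and these correspond to the faces that meet a mark.\<close>

lemma circuit_rank_color_contracted:
  assumes "i \<in> {1..D}"
  shows "circuit_rank (color_part contracted fst i) = int (card (external_faces i))"
proof -
  let ?G = "color_part contracted fst i" and ?T = "color_corner M i ` C"
  let ?f = "face_succ (color_submap M i)"
  have simps: "verts ?G = verts contracted" "tail ?G = tail contracted" "head ?G = head contracted"
    "arcs ?G = {i} \<times> C"
    using assms by (auto simp: color_part_def contracted_simps)
  have "wf_digraph ?G"
    using wf_contracted assms by (auto simp: wf_digraph_def color_part_def)
  then have "components ?G = conn_classes (verts contracted) (tail contracted) (head contracted) ({i} \<times> C)"
    by (simp only: wf_digraph.components_eq_conn_classes simps)
  also have "verts contracted = (vertex_pair \<circ> corner_vertex M) ` ?T"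
    unfolding contracted_simps image_comp[symmetric] color_corner_C ..
  also have "card (conn_classes \<dots> (tail contracted) (head contracted) ({i} \<times> C)) = card (orbit ?f ` ?T)"
  proof (rule card_conn_classes_first_return[OF permutation_color_face,
        where s = "\<lambda>e. color_corner M i (snd e)"])
    show "inj_on (vertex_pair \<circ> corner_vertex M) ?T"
      by (rule comp_inj_on[OF color_corner_C(3) vertex_pair_inj])
    show "(\<lambda>e. color_corner M i (snd e)) ` ({i} \<times> C) = ?T" by force
    fix e assume "e \<in> {i} \<times> C"
    then obtain c where c: "e = (i, c)" "c \<in> C" by auto
    show "tail contracted e = (vertex_pair \<circ> corner_vertex M) (color_corner M i (snd e))"
      using c C_subset by (simp add: contracted_simps color_corner(2) subset_iff)
    show "head contracted e
        = (vertex_pair \<circ> corner_vertex M) (first_return ?f ?T (color_corner M i (snd e)))"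
      using c by (simp add: contracted_simps next_marked_def)
  qed
  also have "orbit ?f ` ?T = external_faces i"
  proof
    show "orbit ?f ` ?T \<subseteq> external_faces i"
      using color_corner_C(1)[of i] permutation_self_in_orbit[OF permutation_color_face]
      by (auto simp: faces_def) blast
    show "external_faces i \<subseteq> orbit ?f ` ?T"
      using orbit_eq_iff[OF permutation_color_face] by (auto simp: faces_def)
  qed
  finally have "card (components ?G) = card (external_faces i)" .
  then show ?thesis
    unfolding circuit_rank_def simps(1) card_verts_contracted
    by (simp add: simps card_cartesian_product)
qed

lemma polychromatic_rank_contracted:
  assumes "connected boundary"
  shows "polychromatic_rank D contracted fst
    = (int D - 1) * int (card C) + 1 - (\<Sum>i\<in>{1..D}. int (card (external_faces i)))"
  unfolding polychromatic_rank_def circuit_rank_contracted[OF assms]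
  by (simp add: circuit_rank_color_contracted algebra_simps)

section \<open>External components and the remaining edges\<close>

lemma color_comps_eq: "color_comps i = classes (edges i)"
  using oriented_map.components_orient[OF oriented_map_color_submap, of i] color_submap_simps by simp

lemma X_eq: "X i = \<Union>{S \<in> color_comps i. S \<inter> MV \<noteq> {}}"
  by (simp add: external_part_def Let_def)

lemma X_subset: "X i \<subseteq> V"
proof -
  have "S \<subseteq> V" if "S \<in> color_comps i" for S
    using that unfolding color_comps_eq
    by (rule econn_class_subset[rotated]) (use orient_ends in auto)
  then show ?thesis unfolding X_eq by blast
qed

lemma X_closed:
  assumes "(u, v) \<in> conn (edges i)" "u \<in> X i"
  shows "v \<in> X i"
proof -
  obtain S where S: "S \<in> color_comps i" "S \<inter> MV \<noteq> {}" "u \<in> S" using assms(2) unfolding X_eq by blast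
  then have "S = conn (edges i) `` {u}" unfolding color_comps_eq by (intro conn_classes_eq_class)
  then have "v \<in> S" using assms(1) by simp
  then show ?thesis using S unfolding X_eq by blast
qed

lemma marked_subset_X: "MV \<subseteq> X i"
proof
  fix v assume v: "v \<in> MV"
  then have "conn (edges i) `` {v} \<in> color_comps i"
    using marked_verts_subset unfolding color_comps_eq conn_classes_def by blast
  moreover have "v \<in> conn (edges i) `` {v}" by simp
  ultimately show "v \<in> X i" using v unfolding X_eq by blast
qed

text \<open>Both ends of an edge lie in the same component of its color. Testing one end thus
  decides whether the edge is external.\<close>

lemma X_ends:
  assumes "a \<in> arcs (mgraph M)"
  shows "tail (mgraph M) a \<in> X (ecol M a) \<longleftrightarrow> head (mgraph M) a \<in> X (ecol M a)"
proof -
  interpret N: oriented_map D "color_submap M (ecol M a)" "edges (ecol M a)"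
    by (rule oriented_map_color_submap)
  have "a \<in> arcs (mgraph (color_submap M (ecol M a)))" using assms by (simp add: color_submap_simps)
  from econn_edge[OF this, of "tail (mgraph (color_submap M (ecol M a)))" "head (mgraph (color_submap M (ecol M a)))"]
  have "(tail (mgraph M) a, head (mgraph M) a) \<in> conn (edges (ecol M a))"
    unfolding N.arcs_orient N.econn_arcs[OF subset_refl] unfolding color_submap_simps(3,4) .
  from X_closed[OF this] X_closed[OF econn_sym[OF this]] show ?thesis by blast
qed

definition rest :: "nat \<Rightarrow> 'b set" where
  "rest i = {a \<in> R. ecol M a = i \<and> tail (mgraph M) a \<notin> X i}"

definition all_rest :: "'b set" where
  "all_rest = (\<Union>i\<in>{1..D}. rest i)"

lemma all_rest_eq: "all_rest = {a \<in> R. tail (mgraph M) a \<notin> X (ecol M a)}"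
  using ecol_range orient_subset by (auto simp: all_rest_def rest_def)

lemma all_rest_subset: "all_rest \<subseteq> R"
  by (auto simp: all_rest_eq)

lemma rest_subset: "rest i \<subseteq> edges i"
  by (auto simp: rest_def)

lemma finite_rest: "finite (rest i)"
  using finite_orient by (auto simp: rest_def)

lemma external_complement_simps:
  "verts (external_complement D M C) = V"
  "tail (external_complement D M C) = tail (mgraph M)"
  "head (external_complement D M C) = head (mgraph M)"
  "arcs (external_complement D M C) = all_rest \<union> erev M ` all_rest"
proof -
  have ext: "arcs (external_part M C i) = {a \<in> arcs (mgraph M). ecol M a = i \<and> tail (mgraph M) a \<in> X i}" for i
  proof -
    have "arcs (external_part M C i)
        = {a \<in> arcs (mgraph M). ecol M a = i \<and> tail (mgraph M) a \<in> X i \<and> head (mgraph M) a \<in> X i}"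
      by (auto simp: external_part_def Let_def color_submap_simps)
    then show ?thesis using X_ends by auto
  qed
  have "arcs (external_complement D M C) = {a \<in> arcs (mgraph M). tail (mgraph M) a \<notin> X (ecol M a)}"
    unfolding external_complement_def ext using ecol_range by auto
  also have "\<dots> = all_rest \<union> erev M ` all_rest"
  proof
    show "all_rest \<union> erev M ` all_rest \<subseteq> {a \<in> arcs (mgraph M). tail (mgraph M) a \<notin> X (ecol M a)}"
    proof
      fix a assume "a \<in> all_rest \<union> erev M ` all_rest"
      then obtain b where b: "b \<in> R" "tail (mgraph M) b \<notin> X (ecol M b)" "a = b \<or> a = erev M b"
        by (auto simp: all_rest_eq)
      have "b \<in> arcs (mgraph M)" using b(1) orient_subset by blast
      then show "a \<in> {a \<in> arcs (mgraph M). tail (mgraph M) a \<notin> X (ecol M a)}"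
        using b X_ends[of b] by (auto simp: ecol_erev)
    qed
    show "{a \<in> arcs (mgraph M). tail (mgraph M) a \<notin> X (ecol M a)} \<subseteq> all_rest \<union> erev M ` all_rest"
    proof
      fix a assume "a \<in> {a \<in> arcs (mgraph M). tail (mgraph M) a \<notin> X (ecol M a)}"
      then have a: "a \<in> arcs (mgraph M)" "tail (mgraph M) a \<notin> X (ecol M a)" by auto
      show "a \<in> all_rest \<union> erev M ` all_rest"
      proof (cases "a \<in> R")
        case True
        then show ?thesis using a by (simp add: all_rest_eq)
      next
        case False
        then obtain b where b: "b \<in> R" "a = erev M b" using a(1) arcs_orient by blast
        then have "b \<in> arcs (mgraph M)" using orient_subset by blast
        then show ?thesis using a b X_ends[of b] by (auto simp: ecol_erev all_rest_eq)
      qed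
    qed
  qed
  finally show "arcs (external_complement D M C) = all_rest \<union> erev M ` all_rest" .
qed (simp_all add: external_complement_def)

lemma wf_external_complement: "wf_digraph (external_complement D M C)"
proof
  fix e assume "e \<in> arcs (external_complement D M C)"
  then have "e \<in> arcs (mgraph M)" by (simp add: external_complement_def)
  then show "tail (external_complement D M C) e \<in> verts (external_complement D M C)"
    "head (external_complement D M C) e \<in> verts (external_complement D M C)"
    by (simp_all add: external_complement_simps)
qed

lemma components_external_complement: "components (external_complement D M C) = classes all_rest"
  by (simp add: wf_digraph.components_eq_conn_classes[OF wf_external_complement] conn_classes_def
      external_complement_simps econn_arcs[OF all_rest_subset])

lemma bidirected_forest_external_complement:
  "bidirected_forest (external_complement D M C) (erev M) \<longleftrightarrow> cyc all_rest = 0"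
proof -
  have arcs: "a \<in> arcs (mgraph M)" if "a \<in> arcs (external_complement D M C)" for a
    using that by (simp add: external_complement_def)
  have "bidirected_forest (external_complement D M C) (erev M) \<longleftrightarrow>
      cyclomatic (verts (external_complement D M C)) (tail (external_complement D M C))
        (head (external_complement D M C)) all_rest = 0"
  proof (rule wf_digraph.bidirected_forest_iff_cyclomatic[OF wf_external_complement])
    show "finite (arcs (external_complement D M C))" by (simp add: external_complement_def)
    show "all_rest \<inter> erev M ` all_rest = {}" using orient_disjoint all_rest_subset by blast
  qed (use arcs in \<open>auto simp: external_complement_simps\<close>)
  then show ?thesis by (simp add: external_complement_simps)
qed

lemma external_verts_eq: "external_verts D M C = (\<Union>i\<in>{1..D}. X i)"
  by (simp add: external_verts_def)

text \<open>Deleting the edges of the external components isolates their vertices and leaves the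
  other components of that color intact.\<close>

lemma classes_rest: "classes (rest i) = {S \<in> color_comps i. S \<inter> MV = {}} \<union> (\<lambda>v. {v}) ` X i"
proof -
  have ends: "tail (mgraph M) e \<notin> X i \<and> head (mgraph M) e \<notin> X i" if "e \<in> rest i" for e
    using that X_ends[of e] orient_subset by (auto simp: rest_def)
  have in_X: "conn (rest i) `` {v} = {v}" if v: "v \<in> X i" for v
  proof -
    have "w = v" if "(v, w) \<in> conn (rest i)" for w
      using that by (induction rule: econn_induct) (use ends v in auto)
    then show ?thesis by auto
  qed
  have notin_X: "conn (rest i) `` {v} = conn (edges i) `` {v}" if v: "v \<notin> X i" for v
  proof
    show "conn (rest i) `` {v} \<subseteq> conn (edges i) `` {v}"
      using econn_mono[OF rest_subset] by blast
    have out: "w \<notin> X i" if "(v, w) \<in> conn (rest i)" for w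
      using that by (induction rule: econn_induct) (use ends v in auto)
    show "conn (edges i) `` {v} \<subseteq> conn (rest i) `` {v}"
    proof
      fix w assume "w \<in> conn (edges i) `` {v}"
      then have "(v, w) \<in> conn (edges i)" by simp
      then have "(v, w) \<in> conn (rest i)"
      proof (induction rule: econn_induct)
        case base
        then show ?case by simp
      next
        case (step e)
        show ?case
        proof (cases "e \<in> rest i")
          case True
          then show ?thesis using econn_edge[OF True] by (meson econn_sym econn_trans)
        next
          case False
          then have "tail (mgraph M) e \<in> X i" using step by (auto simp: rest_def)
          moreover from this have "head (mgraph M) e \<in> X i"
            using X_ends[of e] step orient_subset by auto
          ultimately show ?thesis using out by blast
        qed
      qed
      then show "w \<in> conn (rest i) `` {v}" by simp
    qed
  qed
  show ?thesis
  proof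
    show "classes (rest i) \<subseteq> {S \<in> color_comps i. S \<inter> MV = {}} \<union> (\<lambda>v. {v}) ` X i"
    proof
      fix S assume "S \<in> classes (rest i)"
      then obtain v where v: "v \<in> V" "S = conn (rest i) `` {v}" by (auto simp: conn_classes_def)
      show "S \<in> {S \<in> color_comps i. S \<inter> MV = {}} \<union> (\<lambda>v. {v}) ` X i"
      proof (cases "v \<in> X i")
        case True
        then show ?thesis using in_X v by simp
      next
        case False
        then have "S = conn (edges i) `` {v}" using notin_X v by simp
        then have "S \<in> color_comps i" "v \<in> S" using v(1) by (auto simp: color_comps_eq conn_classes_def)
        then show ?thesis using False unfolding X_eq by blast
      qed
    qed
    show "{S \<in> color_comps i. S \<inter> MV = {}} \<union> (\<lambda>v. {v}) ` X i \<subseteq> classes (rest i)"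
    proof
      fix S assume "S \<in> {S \<in> color_comps i. S \<inter> MV = {}} \<union> (\<lambda>v. {v}) ` X i"
      then consider "S \<in> color_comps i" "S \<inter> MV = {}" | v where "v \<in> X i" "S = {v}" by blast
      then show "S \<in> classes (rest i)"
      proof cases
        case 1
        then obtain v where v: "v \<in> V" "S = conn (edges i) `` {v}"
          by (auto simp: color_comps_eq conn_classes_def)
        have "v \<notin> X i"
        proof
          assume "v \<in> X i"
          then obtain S' where S': "S' \<in> color_comps i" "S' \<inter> MV \<noteq> {}" "v \<in> S'"
            unfolding X_eq by blast
          then have "S' = S"
            using conn_classes_eq_class[of S' V _ _ "edges i" v] v(2) by (simp add: color_comps_eq)
          then show False using 1 S' by simp
        qed
        then show ?thesis using notin_X v by (auto simp: conn_classes_def)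
      next
        case 2
        then show ?thesis using in_X X_subset by (force simp: conn_classes_def)
      qed
    qed
  qed
qed

lemma finite_color_comps: "finite (color_comps i)"
  by (simp add: color_comps_eq conn_classes_def)

lemma finite_X: "finite (X i)"
  using X_subset finite_verts by (rule finite_subset)

text \<open>The two kinds of classes are disjoint: a component \<open>{v}\<close> with
  \<open>v\<close> in \<open>X i\<close> would be the external component of \<open>v\<close> and so
  meet a mark.\<close>

lemma card_classes_rest:
  "card (classes (rest i)) + card {S \<in> color_comps i. S \<inter> MV \<noteq> {}} = card (color_comps i) + card (X i)"
proof -
  have "S \<noteq> {v}" if "S \<in> color_comps i" "S \<inter> MV = {}" "v \<in> X i" for S v
  proof
    assume "S = {v}"
    obtain S' where S': "S' \<in> color_comps i" "S' \<inter> MV \<noteq> {}" "v \<in> S'"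
      using \<open>v \<in> X i\<close> unfolding X_eq by blast
    have "S = conn (edges i) `` {v}" "S' = conn (edges i) `` {v}"
      using that(1) S' \<open>S = {v}\<close> by (auto simp: color_comps_eq intro!: conn_classes_eq_class)
    then show False using that(2) S' by simp
  qed
  then have "{S \<in> color_comps i. S \<inter> MV = {}} \<inter> (\<lambda>v. {v}) ` X i = {}" by blast
  then have "card (classes (rest i)) = card {S \<in> color_comps i. S \<inter> MV = {}} + card (X i)"
    unfolding classes_rest using finite_color_comps finite_X
    by (subst card_Un_disjoint) (auto simp: card_image)
  moreover have "card (color_comps i)
      = card {S \<in> color_comps i. S \<inter> MV = {}} + card {S \<in> color_comps i. S \<inter> MV \<noteq> {}}"
    using finite_color_comps
    by (subst card_Un_disjoint[symmetric]) (auto intro: arg_cong[where f = card])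
  ultimately show ?thesis by simp
qed

section \<open>The nonnegative terms of the count and their vanishing\<close>

abbreviation "XX \<equiv> external_verts D M C"
abbreviation "marked_comps i \<equiv> {S \<in> color_comps i. S \<inter> MV \<noteq> {}}"

lemma card_orient: "card R = (\<Sum>i\<in>{1..D}. card (edges i))"
proof -
  have "R = (\<Union>i\<in>{1..D}. edges i)" using ecol_range orient_subset by auto
  then have "card R = card (\<Union>i\<in>{1..D}. edges i)" by simp
  also have "\<dots> = (\<Sum>i\<in>{1..D}. card (edges i))"
    using finite_orient by (intro card_UN_disjoint) auto
  finally show ?thesis .
qed

lemma card_all_rest: "card all_rest = (\<Sum>i\<in>{1..D}. card (rest i))"
  unfolding all_rest_def using finite_rest by (intro card_UN_disjoint) (auto simp: rest_def)

lemma edges_ends: "e \<in> edges i \<Longrightarrow> tail (mgraph M) e \<in> V \<and> head (mgraph M) e \<in> V"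
  using orient_ends by simp

lemma sum_cyc_rest_le: "(\<Sum>i\<in>{1..D}. cyc (rest i)) \<le> cyc all_rest"
  unfolding all_rest_def
proof (rule sum_cyclomatic_le)
  show "tail (mgraph M) e \<in> V \<and> head (mgraph M) e \<in> V" if "e \<in> rest i" for i e
    using edges_ends rest_subset that by blast
qed (auto simp: finite_rest, auto simp: rest_def)

lemma cyc_edges_nonneg: "0 \<le> cyc (edges i)"
  using finite_orient edges_ends by (intro cyclomatic_nonneg) auto

lemma cyc_rest_le: "cyc (rest i) \<le> cyc (edges i)"
  using finite_orient edges_ends rest_subset by (intro cyclomatic_mono) auto

lemma cyc_rest_nonneg: "0 \<le> cyc (rest i)"
  by (rule cyclomatic_nonneg[OF finite_verts finite_rest]) (rule edges_ends[OF subsetD[OF rest_subset]])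

lemma card_color_faces_le: "int (card (faces (color_submap M i))) \<le> cyc (edges i) + int (card (color_comps i))"
  using oriented_map.card_faces_le[OF oriented_map_color_submap, of i] by (simp only: color_submap_simps)

lemma card_color_faces_forest:
  assumes "cyc (edges i) = 0"
  shows "card (faces (color_submap M i)) = card (color_comps i)"
  using oriented_map.card_faces_forest[OF oriented_map_color_submap, of i] assms
  by (simp only: color_submap_simps)

lemma card_marked_comps_le: "card (marked_comps i) \<le> card (external_faces i)"
  using oriented_map.card_marked_components_le[OF oriented_map_color_submap color_corner_C(1), of i]
  by (simp only: corner_vertex_color_submap color_corner_C(2) cong: image_cong)

lemma card_marked_comps_forest:
  assumes "cyc (edges i) = 0"
  shows "card (marked_comps i) = card (external_faces i)"
  using oriented_map.card_marked_components_forest[OF oriented_map_color_submap _ color_corner_C(1), of i] assms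
  by (simp only: corner_vertex_color_submap color_corner_C(2) color_submap_simps cong: image_cong)

lemma bidirected_forest_color:
  "bidirected_forest (mgraph (color_submap M i)) (erev (color_submap M i)) \<longleftrightarrow> cyc (edges i) = 0"
  using oriented_map.bidirected_forest_orient[OF oriented_map_color_submap, of i]
  by (simp only: color_submap_simps(1,3,4))

text \<open>An unmarked vertex lying in some of the \<open>X i\<close> contributes their number less
  one; overlaps at marked vertices are free.\<close>

definition disjointness_defect :: int where
  "disjointness_defect = (\<Sum>i\<in>{1..D}. int (card (X i - MV))) - int (card (XX - MV))"

lemma external_verts_diff: "XX - MV = (\<Union>i\<in>{1..D}. X i - MV)"
  by (auto simp: external_verts_eq)

lemma disjointness_defect_nonneg: "0 \<le> disjointness_defect"
proof -
  have "card (XX - MV) \<le> (\<Sum>i\<in>{1..D}. card (X i - MV))"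
    unfolding external_verts_diff by (rule card_UN_le) simp
  then have "int (card (XX - MV)) \<le> int (\<Sum>i\<in>{1..D}. card (X i - MV))" by (rule of_nat_mono)
  then show ?thesis by (simp add: disjointness_defect_def)
qed

lemma disjointness_defect_eq_0_iff:
  "disjointness_defect = 0 \<longleftrightarrow> (\<forall>i\<in>{1..D}. \<forall>j\<in>{1..D}. i \<noteq> j \<longrightarrow> X i \<inter> X j \<subseteq> MV)"
proof
  assume "disjointness_defect = 0"
  then have "int (card (XX - MV)) = int (\<Sum>i\<in>{1..D}. card (X i - MV))"
    by (simp add: disjointness_defect_def)
  then have card: "card (\<Union>i\<in>{1..D}. X i - MV) = (\<Sum>i\<in>{1..D}. card (X i - MV))"
    unfolding external_verts_diff by (simp only: of_nat_eq_iff)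
  have "(X i - MV) \<inter> (X j - MV) = {}" if "i \<in> {1..D}" "j \<in> {1..D}" "i \<noteq> j" for i j
    by (rule card_UN_eq_sum_imp_disjoint[where A = "\<lambda>i. X i - MV", OF _ _ card that])
      (simp_all add: finite_X)
  then show "\<forall>i\<in>{1..D}. \<forall>j\<in>{1..D}. i \<noteq> j \<longrightarrow> X i \<inter> X j \<subseteq> MV" by blast
next
  assume "\<forall>i\<in>{1..D}. \<forall>j\<in>{1..D}. i \<noteq> j \<longrightarrow> X i \<inter> X j \<subseteq> MV"
  then have "card (\<Union>i\<in>{1..D}. X i - MV) = (\<Sum>i\<in>{1..D}. card (X i - MV))"
    by (intro card_UN_disjoint) (auto simp: finite_X)
  then show "disjointness_defect = 0"
    unfolding disjointness_defect_def external_verts_diff by simp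
qed

text \<open>Every \<open>X i\<close> contains all marked vertices, so each difference loses exactly
  \<open>card C\<close>; for \<open>XX\<close> this takes at least one color.\<close>

lemma disjointness_defect_alt:
  assumes "1 \<le> D"
  shows "disjointness_defect = (\<Sum>i\<in>{1..D}. int (card (X i))) - int D * int (card C)
    - int (card XX) + int (card C)"
proof -
  have fin: "finite MV" using marked_verts_subset finite_verts by (rule finite_subset)
  have diff: "int (card (A - MV)) = int (card A) - int (card C)" if "MV \<subseteq> A" "finite A" for A
    using card_Diff_subset[OF fin that(1)] card_mono[OF that(2,1)] by (simp add: card_marked_verts)
  have "MV \<subseteq> XX" using assms marked_subset_X[of 1] by (auto simp: external_verts_eq)
  moreover have "finite XX" by (simp add: external_verts_eq finite_X)
  ultimately show ?thesis
    unfolding disjointness_defect_def by (simp add: diff marked_subset_X finite_X sum_subtractf)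
qed

text \<open>Being joined by remaining edges to some vertex of \<open>XX\<close> is invariant along
  every edge of the connected map: a remaining edge keeps the witness, and any other edge has both
  ends in \<open>XX\<close>.\<close>

lemma classes_all_rest_eq:
  assumes "connected (mgraph M)" "C \<noteq> {}" "1 \<le> D"
  shows "classes all_rest = (\<lambda>v. conn all_rest `` {v}) ` XX"
proof
  obtain c where c: "c \<in> C" using assms(2) by blast
  define x where "x = corner_vertex M c"
  have "x \<in> MV" using c by (simp add: x_def marked_verts_def)
  then have x: "x \<in> XX" "x \<in> V"
    using assms(3) marked_subset_X[of 1] marked_verts_subset by (auto simp: external_verts_eq)
  have "\<exists>y\<in>XX. (y, v) \<in> conn all_rest" if v: "v \<in> V" for v
  proof -
    have "(x, v) \<in> conn (arcs (mgraph M))" using assms(1) x v by (simp add: connected_iff_econn)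
    then have "(x, v) \<in> conn R" using econn_arcs[of R] arcs_orient by simp
    then show ?thesis
    proof (induction rule: econn_induct)
      case base
      then show ?case using x by (intro bexI[of _ x]) simp_all
    next
      case (step e)
      have e: "e \<in> arcs (mgraph M)" using step orient_subset by blast
      show ?case
      proof (cases "e \<in> all_rest")
        case True
        then show ?thesis using econn_edge[OF True] by (meson econn_sym econn_trans)
      next
        case False
        then have "tail (mgraph M) e \<in> X (ecol M e)" using step by (simp add: all_rest_eq)
        moreover from this have "head (mgraph M) e \<in> X (ecol M e)" using X_ends[OF e] by simp
        ultimately have "tail (mgraph M) e \<in> XX" "head (mgraph M) e \<in> XX"
          using ecol_range[OF e] unfolding external_verts_eq by blast+
        then show ?thesis by (meson econn_refl)
      qed
    qed
  qed
  then have "\<exists>y\<in>XX. conn all_rest `` {v} = conn all_rest `` {y}" if "v \<in> V" for v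
    unfolding econn_class_eq_iff using that econn_sym by fast
  then show "classes all_rest \<subseteq> (\<lambda>v. conn all_rest `` {v}) ` XX"
    unfolding conn_classes_def by blast
  have "XX \<subseteq> V" using X_subset by (auto simp: external_verts_eq)
  then show "(\<lambda>v. conn all_rest `` {v}) ` XX \<subseteq> classes all_rest"
    unfolding conn_classes_def by blast
qed

lemma finite_external_verts: "finite XX"
  by (simp add: external_verts_eq finite_X)

lemma card_classes_all_rest_le:
  assumes "connected (mgraph M)" "C \<noteq> {}" "1 \<le> D"
  shows "card (classes all_rest) \<le> card XX"
  unfolding classes_all_rest_eq[OF assms] by (rule card_image_le[OF finite_external_verts])

text \<open>The map from \<open>XX\<close> to the remaining components is onto, so equality of the
  cardinalities amounts to its injectivity.\<close>

lemma card_classes_all_rest_eq_iff: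
  assumes "connected (mgraph M)" "C \<noteq> {}" "1 \<le> D"
  shows "card (classes all_rest) = card XX \<longleftrightarrow> (\<forall>S\<in>classes all_rest. \<exists>!v. v \<in> S \<and> v \<in> XX)"
proof -
  let ?c = "\<lambda>v. conn all_rest `` {v}"
  note eq = classes_all_rest_eq[OF assms]
  have "card (classes all_rest) = card XX \<longleftrightarrow> inj_on ?c XX"
    unfolding eq using inj_on_iff_eq_card[OF finite_external_verts, of ?c] by simp
  also have "\<dots> \<longleftrightarrow> (\<forall>S\<in>classes all_rest. \<exists>!v. v \<in> S \<and> v \<in> XX)"
  proof
    assume inj: "inj_on ?c XX"
    show "\<forall>S\<in>classes all_rest. \<exists>!v. v \<in> S \<and> v \<in> XX"
    proof
      fix S assume S: "S \<in> classes all_rest"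
      then obtain x where x: "x \<in> XX" "S = ?c x" unfolding eq by blast
      show "\<exists>!v. v \<in> S \<and> v \<in> XX"
      proof
        show "x \<in> S \<and> x \<in> XX" using x by simp
        fix v assume v: "v \<in> S \<and> v \<in> XX"
        then have "S = ?c v" using S by (intro conn_classes_eq_class) auto
        then show "v = x" using inj_onD[OF inj, of v x] v x by metis
      qed
    qed
  next
    assume unique: "\<forall>S\<in>classes all_rest. \<exists>!v. v \<in> S \<and> v \<in> XX"
    show "inj_on ?c XX"
    proof (rule inj_onI)
      fix u v assume uv: "u \<in> XX" "v \<in> XX" "?c u = ?c v"
      have "?c u \<in> classes all_rest" unfolding eq using uv(1) by blast
      with unique have ex1: "\<exists>!w. w \<in> ?c u \<and> w \<in> XX" by (rule bspec)
      have "v \<in> ?c v" by simp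
      then have "v \<in> ?c u" by (simp only: uv(3))
      then show "u = v" using uv(1,2) ex1 by (metis Image_singleton_iff econn_refl)
    qed
  qed
  finally show ?thesis .
qed

section \<open>The excess of the degree over the bound\<close>

lemma degree_excess:
  assumes "connected boundary" "1 \<le> D"
  shows "degree D M C - (1 + (int D - 1) * (int (card C) + polychromatic_rank D contracted fst))
    = (int D - 2) * (\<Sum>i\<in>{1..D}. cyc (edges i))
      + (\<Sum>i\<in>{1..D}. cyc (edges i) + int (card (color_comps i)) - int (card (faces (color_submap M i))))
      + int D * ((\<Sum>i\<in>{1..D}. int (card (external_faces i)) - int (card (marked_comps i)))
          + (cyc all_rest - (\<Sum>i\<in>{1..D}. cyc (rest i)))
          + disjointness_defect
          + (int (card XX) - int (card (classes all_rest))))"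
proof -
  define E where "E = (\<Sum>i\<in>{1..D}. int (card (edges i)))"
  define K where "K = (\<Sum>i\<in>{1..D}. int (card (color_comps i)))"
  define Fi where "Fi = (\<Sum>i\<in>{1..D}. int (card (internal_faces M C i)))"
  define Fe where "Fe = (\<Sum>i\<in>{1..D}. int (card (external_faces i)))"
  define Ke where "Ke = (\<Sum>i\<in>{1..D}. int (card (marked_comps i)))"
  define Er where "Er = (\<Sum>i\<in>{1..D}. int (card (rest i)))"
  define x where "x = (\<Sum>i\<in>{1..D}. int (card (X i)))"
  have L: "(\<Sum>i\<in>{1..D}. cyc (edges i)) = E - int D * int (card V) + K"
    by (simp add: cyclomatic_def color_comps_eq E_def K_def sum.distrib sum_subtractf)
  have F: "(\<Sum>i\<in>{1..D}. int (card (faces (color_submap M i)))) = Fi + Fe"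
    by (simp add: card_faces_split Fi_def Fe_def sum.distrib)
  have "int (card (classes (rest i))) = int (card (color_comps i)) + int (card (X i)) - int (card (marked_comps i))"
    for i using card_classes_rest[of i] by linarith
  then have Lr: "(\<Sum>i\<in>{1..D}. cyc (rest i)) = Er - int D * int (card V) + (K + x - Ke)"
    by (simp add: cyclomatic_def Er_def K_def x_def Ke_def sum.distrib sum_subtractf)
  have deg: "degree D M C = int D + (int D - 1) * E - Fi"
    by (simp add: degree_def card_map_edges card_orient E_def Fi_def)
  have rank: "polychromatic_rank D contracted fst = (int D - 1) * int (card C) + 1 - Fe"
    by (simp add: polychromatic_rank_contracted[OF assms(1)] Fe_def)
  have L': "cyc all_rest = Er - int (card V) + int (card (classes all_rest))"
    by (simp add: cyclomatic_def card_all_rest Er_def)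
  have defect: "disjointness_defect = x - int D * int (card C) - int (card XX) + int (card C)"
    by (simp add: disjointness_defect_alt[OF assms(2)] x_def)
  \<comment> \<open>A linear identity is left: \<open>Er\<close> cancels between
    \<open>cyc all_rest\<close> and the ranks of its colors, and so do all terms in
    \<open>K\<close>, \<open>Ke\<close>, \<open>x\<close> and \<open>card V\<close>.\<close>
  show ?thesis
    unfolding sum_subtractf sum.distrib L F Lr deg rank L' defect
      Fe_def[symmetric] Ke_def[symmetric] K_def[symmetric]
    by (simp add: algebra_simps)
qed

text \<open>All terms of the excess are nonnegative. As \<open>D\<close> is at least 3, the total
  rank of the colors has a positive coefficient, so equality makes every color a forest; then the
  genus and face terms vanish by themselves and the superadditivity term becomes
  \<open>cyc all_rest\<close>.\<close>

lemma degree_bound: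
  assumes "3 \<le> D" "C \<noteq> {}" "connected (mgraph M)" "connected boundary"
  defines "bound \<equiv> 1 + (int D - 1) * (int (card C) + polychromatic_rank D contracted fst)"
  shows "bound \<le> degree D M C"
    and "degree D M C = bound \<longleftrightarrow> (\<forall>i\<in>{1..D}. cyc (edges i) = 0)
      \<and> disjointness_defect = 0 \<and> cyc all_rest = 0 \<and> card (classes all_rest) = card XX"
proof -
  have D: "1 \<le> D" using assms(1) by simp
  define l where "l = (\<Sum>i\<in>{1..D}. cyc (edges i))"
  define s where "s = (\<Sum>i\<in>{1..D}. cyc (edges i) + int (card (color_comps i)) - int (card (faces (color_submap M i))))"
  define f where "f = (\<Sum>i\<in>{1..D}. int (card (external_faces i)) - int (card (marked_comps i)))"
  define r where "r = cyc all_rest - (\<Sum>i\<in>{1..D}. cyc (rest i))"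
  define b where "b = int (card XX) - int (card (classes all_rest))"
  have excess: "degree D M C - bound = (int D - 2) * l + s + int D * (f + r + disjointness_defect + b)"
    unfolding bound_def degree_excess[OF assms(4) D] l_def s_def f_def r_def b_def ..
  have l: "0 \<le> l" unfolding l_def by (intro sum_nonneg cyc_edges_nonneg)
  have s: "0 \<le> s" unfolding s_def using card_color_faces_le by (intro sum_nonneg) simp
  have f: "0 \<le> f" unfolding f_def using card_marked_comps_le by (intro sum_nonneg) simp
  have r: "0 \<le> r" unfolding r_def using sum_cyc_rest_le by simp
  have b: "0 \<le> b" unfolding b_def using card_classes_all_rest_le[OF assms(3,2) D] by simp
  note nonneg = f r b disjointness_defect_nonneg
  have prod: "0 \<le> (int D - 2) * l" "0 \<le> int D * (f + r + disjointness_defect + b)"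
    using assms(1) l nonneg by simp_all
  then show "bound \<le> degree D M C" using excess s by linarith
  have l_0: "l = 0 \<longleftrightarrow> (\<forall>i\<in>{1..D}. cyc (edges i) = 0)"
    unfolding l_def using cyc_edges_nonneg by (intro sum_nonneg_eq_0_iff) auto
  have forest: "s = 0 \<and> f = 0 \<and> r = cyc all_rest" if "l = 0"
  proof -
    have cyc_0: "cyc (edges i) = 0" if "i \<in> {1..D}" for i using \<open>l = 0\<close> l_0 that by blast
    have "cyc (rest i) = 0" if "i \<in> {1..D}" for i
      using cyc_rest_le[of i] cyc_rest_nonneg[of i] cyc_0[OF that] by simp
    then show ?thesis
      unfolding s_def f_def r_def
      by (simp add: cyc_0 card_color_faces_forest card_marked_comps_forest)
  qed
  have "degree D M C = bound \<longleftrightarrow> (int D - 2) * l + s + int D * (f + r + disjointness_defect + b) = 0"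
    using excess by linarith
  also have "\<dots> \<longleftrightarrow> (int D - 2) * l = 0 \<and> s = 0 \<and> int D * (f + r + disjointness_defect + b) = 0"
    using prod s by linarith
  also have "\<dots> \<longleftrightarrow> l = 0 \<and> s = 0 \<and> f + r + disjointness_defect + b = 0"
    using assms(1) by auto
  also have "\<dots> \<longleftrightarrow> l = 0 \<and> s = 0 \<and> f = 0 \<and> r = 0 \<and> disjointness_defect = 0 \<and> b = 0"
    using nonneg by linarith
  also have "\<dots> \<longleftrightarrow> l = 0 \<and> disjointness_defect = 0 \<and> cyc all_rest = 0 \<and> b = 0"
    using forest by auto
  finally show "degree D M C = bound \<longleftrightarrow> (\<forall>i\<in>{1..D}. cyc (edges i) = 0)
      \<and> disjointness_defect = 0 \<and> cyc all_rest = 0 \<and> card (classes all_rest) = card XX"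
    unfolding l_0 b_def by auto
qed

end

theorem theorem2p4p3:
  fixes D q :: nat
    and M :: "('v, 'h) cmap"
    and C :: "('v, 'h) corner set"
    and B :: "('v \<times> shade, nat \<times> ('v, 'h) corner) pre_digraph"
    and Lm :: int
  assumes "3 \<le> D" and "1 \<le> q"
    and "colored_map D M"
    and "connected (mgraph M)"
    and "marked_corners M C" and "card C = q"
    and B_def: "B = boundary_graph D M C"
    and "connected B"
    and Lm_def: "Lm = polychromatic_rank D (contract B (pairing M C)) fst"
  shows "degree D M C \<ge> 1 + (int D - 1) * (int q + Lm) \<and>
    (degree D M C = 1 + (int D - 1) * (int q + Lm) \<longleftrightarrow>
      (\<forall>i\<in>{1..D}. bidirected_forest (mgraph (color_submap M i)) (erev (color_submap M i)))
      \<and> (\<forall>i\<in>{1..D}. \<forall>j\<in>{1..D}. i \<noteq> j \<longrightarrow>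
           verts (external_part M C i) \<inter> verts (external_part M C j) \<subseteq> marked_verts M C)
      \<and> (bidirected_forest (external_complement D M C) (erev M)
           \<and> (\<forall>S \<in> components (external_complement D M C).
                \<exists>!v. v \<in> S \<and> v \<in> external_verts D M C)))"
proof -
  interpret colored_map D M by fact
  \<comment> \<open>Any orientation will do: it serves to count each edge once and does not occur in
    the claim.\<close>
  obtain R where R: "arcs (mgraph M) = R \<union> erev M ` R" "R \<inter> erev M ` R = {}"
    using ex_orientation by blast
  interpret marked_map D M R C
    by unfold_locales (use R assms(5) in auto)
  have "C \<noteq> {}" using assms(2,6) by auto
  moreover have "connected (boundary_graph D M C)" using assms(8) B_def by simp
  ultimately have bound:
    "1 + (int D - 1) * (int q + Lm) \<le> degree D M C"
    "degree D M C = 1 + (int D - 1) * (int q + Lm) \<longleftrightarrow> (\<forall>i\<in>{1..D}. cyc (edges i) = 0)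
      \<and> disjointness_defect = 0 \<and> cyc all_rest = 0 \<and> card (classes all_rest) = card XX"
    using degree_bound[OF assms(1) _ assms(4)] unfolding Lm_def B_def assms(6)[symmetric] by blast+
  have comps: "card (classes all_rest) = card XX \<longleftrightarrow>
      (\<forall>S \<in> components (external_complement D M C). \<exists>!v. v \<in> S \<and> v \<in> external_verts D M C)"
    using card_classes_all_rest_eq_iff[OF assms(4) \<open>C \<noteq> {}\<close>] assms(1)
    unfolding components_external_complement by simp
  \<comment> \<open>The four vanishing conditions in \<open>bound\<close> are, in turn, (i), (ii)
    and the two halves of (iii).\<close>
  show ?thesis
    unfolding bidirected_forest_color bidirected_forest_external_complement
      disjointness_defect_eq_0_iff[symmetric] comps[symmetric]
    using bound by blast
qed

end
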